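(* Let $\mu\in\mathcal P$, let $\tilde V\subset V_h$ be a linear subspace, and let $u_\mu\in V_h$ and $\widetilde u_\mu\in\tilde V$ be the solutions of $$a_\mu(u_\mu,v)=\langle f_\mu,v\rangle\ \ \forall v\in V_h,\qquad a_\mu(\widetilde u_\mu,v)=\langle f_\mu,v\rangle\ \ \forall v\in\tilde V .$$ Let $\{O_\xi\}_{\xi\in\Upsilon_E}$ be a collection of linear subspaces of $V_h$ with finite index set $\Upsilon_E$, and let $P_{O_\xi}:V_h\to O_\xi\subseteq V_h$, $\xi\in\Upsilon_E$, be continuous linear mappings with $\sum_{\xi\in\Upsilon_E}P_{O_\xi}=\mathrm{id}_{V_h}$. Let $\Upsilon_E=\dot\bigcup_{j=1}^J\Upsilon_{E,j}$ be a partition of $\Upsilon_E$ such that for every $1\le j\le J$ and all $\xi_1\ne\xi_2\in\Upsilon_{E,j}$ the spaces $O_{\xi_1}$ and $O_{\xi_2}$ are orthogonal in $V$. Define $$\Delta_{loc}(\widetilde u_\mu):=\frac1{\alpha_\mu}\,c_{\mathrm{pu},\tilde V}\Big(\sum_{\xi\in\Upsilon_E}\|R_\mu(\widetilde u_\mu)\|_{O_\xi'}^2\Big)^{1/2}.$$ Then $$\|u_\mu-\widetilde u_\mu\|_V\le\Delta_{loc}(\widetilde u_\mu)\le\frac{\gamma_\mu\sqrt J\,c_{\mathrm{pu},\tilde V}}{\alpha_\mu}\,\|u_\mu-\widetilde u_\mu\|_V .$$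
   Context: $\Omega\subset\mathbb R^2$ is a polygonal domain, $V$ is a space with $H^1_0(\Omega)\subset V\subset H^1(\Omega)$, equipped with the standard $H^1$ inner product and induced norm $\|\cdot\|_V$. $V_h\subset V$ is a finite-dimensional (discrete ansatz) subspace with the same inner product and norm. $\mathcal P\subset\mathbb R^p$ is a parameter set; for $\mu\in\mathcal P$, $a_\mu:V\times V\to\mathbb R$ is a coercive, continuous bilinear form and $f_\mu\in V'$. The constants $\alpha_\mu>0$ and $\gamma_\mu$ satisfy $\alpha_\mu\|\varphi\|_V^2\le a_\mu(\varphi,\varphi)$ for all $\varphi\in V$ and $\|a_\mu\|\le\gamma_\mu$, i.e. $|a_\mu(\varphi,\psi)|\le\gamma_\mu\|\varphi\|_V\|\psi\|_V$. The residual $R_\mu(\widetilde u_\mu)\in V_h'$ is $\langle R_\mu(\widetilde u_\mu),\varphi\rangle:=\langle f_\mu,\varphi\rangle-a_\mu(\widetilde u_\mu,\varphi)$ for $\varphi\in V_h$. For $g\in V_h'$ and a subspace $O\subseteq V_h$, $\|g\|_{O'}$ denotes the dual norm (with respect to $\|\cdot\|_V$) of the restriction of $g$ to $O$. The stability constant of the partition modulo $\tilde V$ is $$c_{\mathrm{pu},\tilde V}:=\sup_{\varphi\in V_h\setminus\{0\}}\frac{\big(\sum_{\xi\in\Upsilon_E}\inf_{\tilde\varphi\in\tilde V\cap O_\xi}\|P_{O_\xi}(\varphi)-\tilde\varphi\|_V^2\big)^{1/2}}{\|\varphi\|_V}.$$ *)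

theory Defs
  imports "HOL-Analysis.Analysis"
begin

section \<open>Functions on the plane modulo equality almost everywhere\<close>

type_synonym plane = "real ^ 2"

definition ae_eq :: "(plane \<Rightarrow> real) \<Rightarrow> (plane \<Rightarrow> real) \<Rightarrow> bool" where
  "ae_eq f g \<longleftrightarrow> (AE x in lebesgue. f x = g x)"

quotient_type aefun = "plane \<Rightarrow> real" / ae_eq
proof (rule equivpI)
  show "reflp ae_eq" by (simp add: reflp_def ae_eq_def)
  show "symp ae_eq" by (auto simp: symp_def ae_eq_def elim: eventually_mono)
  show "transp ae_eq"
    unfolding transp_def ae_eq_def
  proof (intro allI impI)
    fix f g h :: "plane \<Rightarrow> real"
    assume "AE x in lebesgue. f x = g x" "AE x in lebesgue. g x = h x"
    then show "AE x in lebesgue. f x = h x" by eventually_elim simp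
  qed
qed

instantiation aefun :: real_vector
begin

lift_definition zero_aefun :: aefun is "\<lambda>x. 0" .

lift_definition plus_aefun :: "aefun \<Rightarrow> aefun \<Rightarrow> aefun" is "\<lambda>f g x. f x + g x"
  unfolding ae_eq_def by (erule (1) eventually_elim2) simp

lift_definition minus_aefun :: "aefun \<Rightarrow> aefun \<Rightarrow> aefun" is "\<lambda>f g x. f x - g x"
  unfolding ae_eq_def by (erule (1) eventually_elim2) simp

lift_definition uminus_aefun :: "aefun \<Rightarrow> aefun" is "\<lambda>f x. - f x"
  unfolding ae_eq_def by (erule eventually_mono) simp

lift_definition scaleR_aefun :: "real \<Rightarrow> aefun \<Rightarrow> aefun" is "\<lambda>c f x. c * f x"
  unfolding ae_eq_def by (erule eventually_mono) simp

instance
  by standard (transfer, simp add: ae_eq_def algebra_simps)+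

end

section \<open>The Sobolev spaces on a plane domain\<close>

text \<open>A function on \<open>\<Omega>\<close> is identified with its extension by zero to the plane.
  All the predicates below are invariant under the choice of the representative
  \<^const>\<open>rep_aefun\<close>, because \<^const>\<open>lebesgue\<close> is complete.\<close>

definition L2_space :: "plane set \<Rightarrow> aefun set" where
  "L2_space \<Omega> = {u. rep_aefun u \<in> borel_measurable lebesgue
      \<and> integrable lebesgue (\<lambda>x. (rep_aefun u x)\<^sup>2)
      \<and> (AE x in lebesgue. x \<notin> \<Omega> \<longrightarrow> rep_aefun u x = 0)}"

definition L2_inner :: "aefun \<Rightarrow> aefun \<Rightarrow> real" where
  "L2_inner u v = (LINT x|lebesgue. rep_aefun u x * rep_aefun v x)"

definition partial :: "2 \<Rightarrow> (plane \<Rightarrow> real) \<Rightarrow> plane \<Rightarrow> real" where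
  "partial i f x = frechet_derivative f (at x) (axis i 1)"

primrec C_k :: "nat \<Rightarrow> (plane \<Rightarrow> real) \<Rightarrow> bool" where
  "C_k 0 f \<longleftrightarrow> continuous_on UNIV f"
| "C_k (Suc k) f \<longleftrightarrow> f differentiable_on UNIV \<and> (\<forall>i. C_k k (partial i f))"

definition test_functions :: "plane set \<Rightarrow> (plane \<Rightarrow> real) set" where
  "test_functions \<Omega> = {\<phi>. (\<forall>k. C_k k \<phi>)
      \<and> compact (closure {x. \<phi> x \<noteq> 0}) \<and> closure {x. \<phi> x \<noteq> 0} \<subseteq> \<Omega>}"

definition has_weak_partial :: "plane set \<Rightarrow> 2 \<Rightarrow> aefun \<Rightarrow> aefun \<Rightarrow> bool" where
  "has_weak_partial \<Omega> i u g \<longleftrightarrow> g \<in> L2_space \<Omega> \<and>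
     (\<forall>\<phi>\<in>test_functions \<Omega>.
        (LINT x|lebesgue. rep_aefun u x * partial i \<phi> x)
          = - (LINT x|lebesgue. rep_aefun g x * \<phi> x))"

text \<open>The weak derivative is unique: on \<open>\<Omega>\<close> by the fundamental lemma of the calculus
  of variations, and off \<open>\<Omega>\<close> because members of \<^const>\<open>L2_space\<close> vanish there.\<close>

definition weak_partial :: "plane set \<Rightarrow> 2 \<Rightarrow> aefun \<Rightarrow> aefun" where
  "weak_partial \<Omega> i u = (THE g. has_weak_partial \<Omega> i u g)"

definition H1 :: "plane set \<Rightarrow> aefun set" where
  "H1 \<Omega> = {u \<in> L2_space \<Omega>. \<forall>i. \<exists>g. has_weak_partial \<Omega> i u g}"

definition H1_inner :: "plane set \<Rightarrow> aefun \<Rightarrow> aefun \<Rightarrow> real" where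
  "H1_inner \<Omega> u v =
     L2_inner u v + (\<Sum>i\<in>UNIV. L2_inner (weak_partial \<Omega> i u) (weak_partial \<Omega> i v))"

definition H1_norm :: "plane set \<Rightarrow> aefun \<Rightarrow> real" where
  "H1_norm \<Omega> u = sqrt (H1_inner \<Omega> u u)"

definition H10 :: "plane set \<Rightarrow> aefun set" where
  "H10 \<Omega> = {u \<in> H1 \<Omega>. \<forall>\<epsilon>>0. \<exists>\<phi>\<in>test_functions \<Omega>. H1_norm \<Omega> (u - abs_aefun \<phi>) < \<epsilon>}"

text \<open>No Lipschitz condition is imposed on the boundary; slits are allowed.\<close>

definition polygonal_domain :: "plane set \<Rightarrow> bool" where
  "polygonal_domain \<Omega> \<longleftrightarrow> \<Omega> \<noteq> {} \<and> open \<Omega> \<and> connected \<Omega> \<and> bounded \<Omega> \<and>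
     (\<exists>S. finite S \<and> frontier \<Omega> = (\<Union>(a, b)\<in>S. closed_segment a b))"

section \<open>Linear and bilinear maps on subspaces\<close>

definition linear_map_on :: "'a::real_vector set \<Rightarrow> ('a \<Rightarrow> 'b::real_vector) \<Rightarrow> bool" where
  "linear_map_on S g \<longleftrightarrow> (\<forall>x\<in>S. \<forall>y\<in>S. g (x + y) = g x + g y) \<and>
     (\<forall>c. \<forall>x\<in>S. g (c *\<^sub>R x) = c *\<^sub>R g x)"

definition bilinear_form_on :: "'a::real_vector set \<Rightarrow> ('a \<Rightarrow> 'a \<Rightarrow> real) \<Rightarrow> bool" where
  "bilinear_form_on S b \<longleftrightarrow>
     (\<forall>x\<in>S. linear_map_on S (b x)) \<and> (\<forall>y\<in>S. linear_map_on S (\<lambda>x. b x y))"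

definition dual_space :: "plane set \<Rightarrow> aefun set \<Rightarrow> (aefun \<Rightarrow> real) set" where
  "dual_space \<Omega> S = {g. linear_map_on S g \<and> (\<exists>C. \<forall>v\<in>S. \<bar>g v\<bar> \<le> C * H1_norm \<Omega> v)}"

definition continuous_linear_map ::
    "plane set \<Rightarrow> aefun set \<Rightarrow> aefun set \<Rightarrow> (aefun \<Rightarrow> aefun) \<Rightarrow> bool" where
  "continuous_linear_map \<Omega> S T g \<longleftrightarrow> linear_map_on S g \<and> g ` S \<subseteq> T \<and>
     (\<exists>C. \<forall>v\<in>S. H1_norm \<Omega> (g v) \<le> C * H1_norm \<Omega> v)"

text \<open>Taking the supremum over the closed unit ball instead of the quotients
  \<open>\<bar>g \<phi>\<bar> / H1_norm \<Omega> \<phi>\<close> gives the value 0 on the zero subspace.\<close>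

definition dual_norm :: "plane set \<Rightarrow> aefun set \<Rightarrow> (aefun \<Rightarrow> real) \<Rightarrow> real" where
  "dual_norm \<Omega> S g = (SUP \<phi>\<in>{\<phi>\<in>S. H1_norm \<Omega> \<phi> \<le> 1}. \<bar>g \<phi>\<bar>)"

section \<open>The localized error estimator\<close>

definition residual ::
    "(aefun \<Rightarrow> aefun \<Rightarrow> real) \<Rightarrow> (aefun \<Rightarrow> real) \<Rightarrow> aefun \<Rightarrow> aefun \<Rightarrow> real" where
  "residual a f u = (\<lambda>\<phi>. f \<phi> - a u \<phi>)"

text \<open>The quotients are nonnegative; inserting 0 only fixes the supremum to be 0 when
  \<open>V\<^sub>h\<close> is the zero space, since \<^const>\<open>Sup\<close> on the reals is unspecified at the empty set.\<close>

definition c_pu ::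
    "plane set \<Rightarrow> aefun set \<Rightarrow> aefun set \<Rightarrow> 'i set \<Rightarrow> ('i \<Rightarrow> aefun set)
       \<Rightarrow> ('i \<Rightarrow> aefun \<Rightarrow> aefun) \<Rightarrow> real" where
  "c_pu \<Omega> Vh Vt \<Upsilon> Os P = Sup (insert 0
     ((\<lambda>\<phi>. sqrt (\<Sum>\<xi>\<in>\<Upsilon>. INF \<psi>\<in>Vt \<inter> Os \<xi>. (H1_norm \<Omega> (P \<xi> \<phi> - \<psi>))\<^sup>2) / H1_norm \<Omega> \<phi>)
        ` (Vh - {0})))"

definition Delta_loc ::
    "plane set \<Rightarrow> aefun set \<Rightarrow> aefun set \<Rightarrow> 'i set \<Rightarrow> ('i \<Rightarrow> aefun set)
       \<Rightarrow> ('i \<Rightarrow> aefun \<Rightarrow> aefun) \<Rightarrow> (aefun \<Rightarrow> aefun \<Rightarrow> real) \<Rightarrow> (aefun \<Rightarrow> real)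
       \<Rightarrow> real \<Rightarrow> aefun \<Rightarrow> real" where
  "Delta_loc \<Omega> Vh Vt \<Upsilon> Os P a f \<alpha> ut =
     1 / \<alpha> * c_pu \<Omega> Vh Vt \<Upsilon> Os P
       * sqrt (\<Sum>\<xi>\<in>\<Upsilon>. (dual_norm \<Omega> (Os \<xi>) (residual a f ut))\<^sup>2)"

end

theory Submission
  imports Defs
begin

text \<open>With \<open>e = u - ut\<close>, coercivity gives \<open>\<alpha> \<parallel>e\<parallel>\<^sup>2 \<le> R(e) = \<Sum> R(P\<^sub>\<xi> e)\<close>. By Galerkin orthogonality
  each \<open>P\<^sub>\<xi> e\<close> may be changed by an element of \<open>Vt \<inter> O\<^sub>\<xi>\<close>, and Cauchy-Schwarz over \<open>\<xi>\<close> yields the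
  upper bound. For efficiency, \<open>R = a(e, \<cdot>)\<close> has norm at most \<open>\<gamma> \<parallel>e\<parallel>\<close>, and on each class of mutually
  orthogonal spaces the squared local dual norms sum to at most the square of that bound; there are
  \<open>J\<close> classes. That the \<open>H\<^sup>1\<close> product is bilinear rests on the uniqueness of weak derivatives,
  hence on the fundamental lemma of the calculus of variations.\<close>

section \<open>Smooth bump functions\<close>

text \<open>The \<open>H1\<close> product is a total function on \<open>aefun\<close>, built from
  chosen representatives and a definite description, and it behaves like an inner product only on
  the carrier \<open>H1 \<Omega>\<close>. Its laws are therefore proved relative to that subspace,
  and three consequences feed the estimates: definiteness, scaling of the norm, and Pythagoras for
  orthogonal families. Additivity of the weak partial derivative comes from exhibiting
  \<open>g + h\<close> as a weak partial derivative of \<open>u + v\<close> and then appealing to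
  uniqueness. Uniqueness tests against smooth functions of compact support, so such functions have
  to be constructed; \<open>exp (- 1 / x)\<close> is their source. The other delicate point is that
  \<open>SUP\<close>, \<open>INF\<close> and \<open>Sup\<close> over the reals are meaningful only
  on nonempty bounded sets. Local dual norms get their bound from continuity of the residual,
  \<open>c_pu\<close> from continuity of the maps \<open>P \<xi>\<close>. Extremizers are never
  chosen: suprema are approached by sequences, infima are bounded below.\<close>

text \<open>The class of functions \<open>p(1/x) exp(-1/x)\<close> is closed under differentiation,
  which gives smoothness without a formula for the iterated derivatives.\<close>

definition flat_fun :: "real poly \<Rightarrow> real \<Rightarrow> real" where
  "flat_fun p x = (if x > 0 then poly p (1 / x) * exp (- 1 / x) else 0)"

lemma poly_times_exp_minus_tendsto_0: "((\<lambda>y. poly p y * exp (- y)) \<longlongrightarrow> (0::real)) at_top"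
proof -
  have "((\<lambda>y. \<Sum>i\<le>degree p. coeff p i * (y ^ i / exp y)) \<longlongrightarrow> (\<Sum>i\<le>degree p. coeff p i * 0)) at_top"
    by (intro tendsto_sum tendsto_mult tendsto_const tendsto_power_div_exp_0)
  then show ?thesis
    by (simp add: poly_altdef sum_divide_distrib exp_minus divide_inverse sum_distrib_right mult.assoc)
qed

text \<open>On the right, the substitution \<open>y = 1 / x\<close> turns the limit at 0 into
  exponential decay at infinity; on the left the function vanishes.\<close>

lemma flat_fun_tendsto_0: "(flat_fun p \<longlongrightarrow> 0) (at 0)"
proof -
  have "((\<lambda>x. poly p (inverse x) * exp (- inverse x)) \<longlongrightarrow> 0) (at_right 0)"
    by (rule filterlim_compose[OF poly_times_exp_minus_tendsto_0 filterlim_inverse_at_top_right])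
  then have "(flat_fun p \<longlongrightarrow> 0) (at_right 0)"
    by (rule Lim_transform_eventually)
       (auto simp: flat_fun_def field_simps eventually_at_right_less intro!: eventually_mono[OF eventually_at_right_less])
  moreover have "(flat_fun p \<longlongrightarrow> 0) (at_left 0)"
    by (rule tendsto_eventually) (auto simp: flat_fun_def eventually_at_filter)
  ultimately show ?thesis
    by (simp add: filterlim_split_at)
qed

text \<open>For positive \<open>x\<close> the product rule gives
  \<open>(1 / x)^2 * (p - p')(1 / x) * exp (- 1 / x)\<close>, and \<open>[:0, 0, 1:]\<close> is the
  polynomial that contributes the square of \<open>1 / x\<close>.\<close>

lemma flat_fun_has_field_derivative:
  "(flat_fun p has_field_derivative flat_fun ([:0, 0, 1:] * (p - pderiv p)) x) (at x)"
proof (cases x "0::real" rule: linorder_cases)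
  case less
  have "((\<lambda>x. 0) has_field_derivative 0) (at x)" by simp
  then have "(flat_fun p has_field_derivative 0) (at x)"
    by (rule has_field_derivative_transform_within_open[where S = "{..<0}"])
       (use less in \<open>auto simp: flat_fun_def\<close>)
  then show ?thesis using less by (simp add: flat_fun_def)
next
  case equal
  \<comment> \<open>\<open>pCons 0 p\<close> is \<open>p\<close> times the indeterminate, so for
    nonzero \<open>y\<close> its flat function is exactly the difference quotient
    \<open>flat_fun p y / y\<close>.\<close>
  have "(flat_fun (pCons 0 p) \<longlongrightarrow> 0) (at 0)" by (rule flat_fun_tendsto_0)
  then have "((\<lambda>y. (flat_fun p y - flat_fun p 0) / (y - 0)) \<longlongrightarrow> 0) (at 0)"
    by (rule Lim_transform_eventually) (auto simp: flat_fun_def eventually_at_filter)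
  then show ?thesis using equal
    by (simp add: has_field_derivative_iff flat_fun_def)
next
  case greater
  have "((\<lambda>x. poly p (1 / x) * exp (- 1 / x)) has_field_derivative
          flat_fun ([:0, 0, 1:] * (p - pderiv p)) x) (at x)"
    using greater
    by (auto intro!: derivative_eq_intros DERIV_chain2[OF poly_DERIV]
        simp: flat_fun_def field_simps power2_eq_square)
  then show ?thesis
    by (rule has_field_derivative_transform_within_open[where S = "{0<..}"])
       (use greater in \<open>auto simp: flat_fun_def\<close>)
qed

section \<open>Calculus of the classes \<open>C_k\<close>\<close>

lemma partial_eqI: "(f has_derivative D) (at x) \<Longrightarrow> partial i f x = D (axis i 1)"
  by (metis frechet_derivative_at partial_def)

lemma differentiable_on_UNIV_has_derivative:
  "f differentiable_on UNIV \<Longrightarrow> (f has_derivative frechet_derivative f (at x)) (at x)"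
  by (simp add: differentiable_on_def frechet_derivative_works)

text \<open>The Leibniz rule leaves undifferentiated factors beside the partial derivatives; this
  lowers their order to the one the induction hypothesis for products asks for.\<close>

lemma C_k_Suc_imp: "C_k (Suc k) f \<Longrightarrow> C_k k f"
proof (induction k arbitrary: f)
  case 0
  then show ?case by (simp add: differentiable_imp_continuous_on)
qed (metis C_k.simps(2))

lemma C_k_imp_continuous: "C_k k f \<Longrightarrow> continuous_on UNIV f"
  by (induction k arbitrary: f) (auto simp: differentiable_imp_continuous_on)

lemma C_k_const: "C_k k (\<lambda>x. c)"
  by (induction k arbitrary: c) (simp_all add: partial_def[abs_def])

lemma C_k_add: "C_k k f \<Longrightarrow> C_k k g \<Longrightarrow> C_k k (\<lambda>x. f x + g x)"
proof (induction k arbitrary: f g)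
  case (Suc k)
  have "partial i (\<lambda>x. f x + g x) = (\<lambda>x. partial i f x + partial i g x)" for i
  proof
    show "partial i (\<lambda>x. f x + g x) x = partial i f x + partial i g x" for x
      using Suc.prems
      by (subst partial_eqI[OF has_derivative_add[OF differentiable_on_UNIV_has_derivative
              differentiable_on_UNIV_has_derivative]]) (auto simp: partial_def)
  qed
  then show ?case using Suc by simp
qed (auto intro: continuous_intros)

lemma C_k_mult: "C_k k f \<Longrightarrow> C_k k g \<Longrightarrow> C_k k (\<lambda>x. f x * g x)"
proof (induction k arbitrary: f g)
  case (Suc k)
  have "partial i (\<lambda>x. f x * g x) = (\<lambda>x. f x * partial i g x + partial i f x * g x)" for i
  proof
    show "partial i (\<lambda>x. f x * g x) x = f x * partial i g x + partial i f x * g x" for x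
      using Suc.prems
      by (subst partial_eqI[OF has_derivative_mult[OF differentiable_on_UNIV_has_derivative
              differentiable_on_UNIV_has_derivative]]) (auto simp: partial_def)
  qed
  moreover have "C_k k f" "C_k k g" using Suc.prems by (blast intro: C_k_Suc_imp)+
  ultimately show ?case using Suc by (auto intro!: C_k_add)
qed (auto intro: continuous_intros)

lemma C_k_prod: "finite I \<Longrightarrow> (\<And>i. i \<in> I \<Longrightarrow> C_k k (f i)) \<Longrightarrow> C_k k (\<lambda>x. \<Prod>i\<in>I. f i x)"
  by (induction I rule: finite_induct) (auto intro: C_k_const C_k_mult)

text \<open>The slope \<open>s\<close> may have either sign, which serves both the lower and the
  upper face of a box. The induction keeps \<open>p\<close> arbitrary because each derivative
  changes the polynomial; the chain rule factor \<open>s * axis j 1 $ i\<close> vanishes unless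
  \<open>j = i\<close>.\<close>

lemma C_k_flat_fun: "C_k k (\<lambda>x. flat_fun p (s * x $ i + d))"
proof (induction k arbitrary: p)
  case 0
  have "continuous_on UNIV (flat_fun p)"
    by (rule DERIV_continuous_on[OF DERIV_subset[OF flat_fun_has_field_derivative]]) simp
  then show ?case
    by (auto intro!: continuous_intros continuous_on_compose2[of UNIV "flat_fun p"])
next
  case (Suc k)
  let ?q = "[:0, 0, 1:] * (p - pderiv p)"
  have D: "((\<lambda>x. flat_fun p (s * x $ i + d)) has_derivative
          (\<lambda>h. flat_fun ?q (s * x $ i + d) * (s * h $ i))) (at x)" for x :: plane
  proof (rule has_derivative_compose[of "\<lambda>x. s * x $ i + d" "\<lambda>h. s * h $ i" x UNIV "flat_fun p"])
    show "((\<lambda>x. s * x $ i + d) has_derivative (\<lambda>h. s * h $ i)) (at x)"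
      by (auto intro!: derivative_eq_intros bounded_linear.has_derivative[OF bounded_linear_vec_nth])
    show "(flat_fun p has_derivative (*) (flat_fun ?q (s * x $ i + d))) (at (s * x $ i + d))"
      using flat_fun_has_field_derivative has_field_derivative_def by blast
  qed
  have "partial j (\<lambda>x. flat_fun p (s * x $ i + d))
      = (\<lambda>x. (s * axis j 1 $ i) * flat_fun ?q (s * x $ i + d))" for j
    by (rule ext, subst partial_eqI[OF D]) simp
  moreover have "(\<lambda>x. flat_fun p (s * x $ i + d)) differentiable_on UNIV"
    using D by (auto simp: differentiable_on_def differentiable_def)
  ultimately show ?case
    using Suc by (auto simp del: mult_pCons_left intro!: C_k_mult C_k_const)
qed

text \<open>The factor \<open>Suc n\<close> makes the bumps increase to the indicator of the open box, because
  \<open>exp (- 1 / (n t))\<close> tends to 1 for every positive \<open>t\<close>.\<close>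

definition box_bump :: "plane \<Rightarrow> plane \<Rightarrow> nat \<Rightarrow> plane \<Rightarrow> real" where
  "box_bump a b n x = (\<Prod>i\<in>UNIV. flat_fun 1 (real (Suc n) * (x $ i - a $ i))
                                 * flat_fun 1 (real (Suc n) * (b $ i - x $ i)))"

lemma flat_fun_1_eq_0_iff: "flat_fun 1 x = 0 \<longleftrightarrow> x \<le> 0"
  by (auto simp: flat_fun_def)

lemma box_bump_eq_0_iff: "box_bump a b n x = 0 \<longleftrightarrow> x \<notin> box a b"
  by (auto simp: box_bump_def flat_fun_1_eq_0_iff mem_box_cart mult_le_0_iff not_less)

lemma box_bump_bounds: "0 \<le> box_bump a b n x" "box_bump a b n x \<le> 1"
proof -
  have "0 \<le> flat_fun 1 t" "flat_fun 1 t \<le> 1" for t by (auto simp: flat_fun_def)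
  then show "0 \<le> box_bump a b n x" "box_bump a b n x \<le> 1"
    by (auto simp: box_bump_def intro!: prod_nonneg prod_le_1 mult_le_one)
qed

lemma box_bump_tendsto: "(\<lambda>n. box_bump a b n x) \<longlonglongrightarrow> indicator (box a b) x"
proof (cases "x \<in> box a b")
  case True
  have *: "(\<lambda>n. flat_fun 1 (real (Suc n) * t)) \<longlonglongrightarrow> 1" if "t > 0" for t
  proof -
    have "(\<lambda>n. exp (- (inverse t * inverse (real (Suc n))))) \<longlonglongrightarrow> exp (- (inverse t * 0))"
      by (intro tendsto_intros LIMSEQ_inverse_real_of_nat)
    moreover have "flat_fun 1 (real (Suc n) * t) = exp (- (inverse t * inverse (real (Suc n))))" for n
      using that by (simp add: flat_fun_def zero_less_mult_iff divide_inverse del: of_nat_Suc)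
    ultimately show ?thesis by simp
  qed
  have "(\<lambda>n. box_bump a b n x) \<longlonglongrightarrow> (\<Prod>i\<in>(UNIV :: 2 set). 1 * 1)"
    unfolding box_bump_def
    using True by (intro tendsto_prod tendsto_mult *) (auto simp: mem_box_cart)
  then show ?thesis using True by simp
next
  case False
  then show ?thesis by (simp add: box_bump_eq_0_iff[THEN iffD2])
qed

text \<open>The support is a closure, so it is the closed box that has to fit inside
  \<open>\<Omega>\<close>, although the bump vanishes outside the open one.\<close>

lemma box_bump_test_function:
  assumes "cbox a b \<subseteq> \<Omega>"
  shows "box_bump a b n \<in> test_functions \<Omega>"
proof -
  have "C_k k (box_bump a b n)" for k
  proof -
    have "box_bump a b n = (\<lambda>x. \<Prod>i\<in>UNIV. flat_fun 1 (real (Suc n) * x $ i + (- real (Suc n) * a $ i))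
                                 * flat_fun 1 (- real (Suc n) * x $ i + real (Suc n) * b $ i))"
      by (intro ext) (simp add: box_bump_def algebra_simps)
    then show ?thesis
      by (simp only:) (intro C_k_prod C_k_mult C_k_flat_fun finite)
  qed
  moreover have sub: "closure {x. box_bump a b n x \<noteq> 0} \<subseteq> cbox a b"
    by (rule closure_minimal) (auto simp: box_bump_eq_0_iff box_subset_cbox[THEN subsetD])
  moreover have "compact (closure {x. box_bump a b n x \<noteq> 0})"
    using sub by (meson bounded_cbox bounded_closure bounded_subset closed_closure closure_subset compact_eq_bounded_closed order_trans)
  ultimately show ?thesis using assms by (auto simp: test_functions_def)
qed

section \<open>The fundamental lemma of the calculus of variations\<close>

text \<open>Dynkin argument: boxes form an intersection-stable generator of the Borel sets, and the
  sets over which \<open>w\<close> integrates to 0 are closed under complements (by the integral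
  over the whole space) and under countable disjoint unions. An integrable density with all set
  integrals 0 vanishes almost everywhere.\<close>

lemma AE_0_if_box_integrals_0:
  fixes w :: "'a::euclidean_space \<Rightarrow> real"
  assumes w: "integrable lborel w"
    and box: "\<And>a b. (LINT x:box a b|lborel. w x) = 0"
    and UNIV: "(LINT x|lborel. w x) = 0"
  shows "AE x in lborel. w x = 0"
proof (rule sigma_finite_measure.density_zero[OF lborel.sigma_finite_measure_axioms w])
  fix A :: "'a set"
  assume "A \<in> sets lborel"
  then have A: "A \<in> sigma_sets UNIV (range (\<lambda>(a, b). box a b))"
    by (simp add: borel_eq_box)
  have "Int_stable (range (\<lambda>(a, b). box a b :: 'a set))"
    by (auto simp: Int_stable_def box_Int_box)
  moreover have "range (\<lambda>(a, b). box a b :: 'a set) \<subseteq> Pow UNIV" by auto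
  moreover note A
  ultimately show "(LINT x:A|lborel. w x) = 0"
  proof (induction rule: sigma_sets_induct_disjoint)
    case (basic A)
    then show ?case using box by auto
  next
    case (compl A)
    have A: "A \<in> sets lborel" using compl.hyps by (simp add: borel_eq_box)
    then have "set_integrable lborel A w" "set_integrable lborel (UNIV - A) w"
      using integrable_mult_indicator[OF _ w] by (auto simp: set_integrable_def)
    then have "(LINT x:(A \<union> (UNIV - A))|lborel. w x)
        = (LINT x:A|lborel. w x) + (LINT x:UNIV - A|lborel. w x)"
      by (intro set_integral_Un) auto
    then show ?case using compl.IH UNIV by (simp add: set_lebesgue_integral_def)
  next
    case (union F)
    have F: "F i \<in> sets lborel" for i using union.hyps(2) by (simp add: borel_eq_box image_subset_iff)
    then have "set_integrable lborel (\<Union>i. F i) w"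
      using integrable_mult_indicator[OF _ w] by (auto simp: set_integrable_def)
    then have "(LINT x:(\<Union>i. F i)|lborel. w x) = (\<Sum>i. LINT x:F i|lborel. w x)"
      using F union.hyps by (intro lebesgue_integral_countable_add) (auto simp: disjoint_family_on_def)
    then show ?case by (simp add: union.IH)
  qed (simp add: set_lebesgue_integral_def)
qed

text \<open>The global statement is localized by cutting off to one box whose closure lies in
  \<open>S\<close>; countably many closed boxes then exhaust \<open>S\<close>.\<close>

lemma AE_0_on_open_if_box_integrals_0:
  fixes w :: "'a::euclidean_space \<Rightarrow> real"
  assumes w: "integrable lebesgue w" and "open S"
    and box: "\<And>a b. cbox a b \<subseteq> S \<Longrightarrow> (LINT x:box a b|lebesgue. w x) = 0"
  shows "AE x in lebesgue. x \<in> S \<longrightarrow> w x = 0"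
proof -
  \<comment> \<open>The Dynkin argument runs over Borel sets, so \<open>w\<close> is replaced by a
    Borel function that agrees with it almost everywhere.\<close>
  obtain w' where w'[measurable]: "w' \<in> borel_measurable lborel" and "AE x in lborel. w x = w' x"
    using completion_ex_borel_measurable_real[of w lborel] w by auto
  then have eq: "AE x in lebesgue. w x = w' x" by (intro AE_completion)
  have "integrable lebesgue w'"
    by (rule integrable_cong_AE_imp[OF w measurable_completion[OF w'] eq])
  then have int: "integrable lborel w'" by (simp add: integrable_completion)
  have box': "(LINT x:box a b|lborel. w' x) = 0" if "cbox a b \<subseteq> S" for a b
  proof -
    have "(LINT x:box a b|lborel. w' x) = (LINT x:box a b|lebesgue. w' x)"
      unfolding set_lebesgue_integral_def
      by (rule integral_completion[symmetric]) simp
    also have "\<dots> = (LINT x:box a b|lebesgue. w x)"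
      unfolding set_lebesgue_integral_def
    proof (rule integral_cong_AE)
      show "(\<lambda>x. indicat_real (box a b) x *\<^sub>R w' x) \<in> borel_measurable lebesgue"
        using measurable_completion[OF w'] by (intro borel_measurable_scaleR borel_measurable_indicator) auto
      show "(\<lambda>x. indicat_real (box a b) x *\<^sub>R w x) \<in> borel_measurable lebesgue"
        using w by (intro borel_measurable_scaleR borel_measurable_indicator) auto
    qed (use eq in auto)
    finally show ?thesis using box[OF that] by simp
  qed
  have zero: "AE x in lebesgue. x \<in> cbox a b \<longrightarrow> w x = 0" if ab: "cbox a b \<subseteq> S" for a b
  proof -
    let ?v = "\<lambda>x. indicat_real (box a b) x *\<^sub>R w' x"
    have "AE x in lborel. ?v x = 0"
    proof (rule AE_0_if_box_integrals_0)
      show "integrable lborel ?v" by (intro integrable_mult_indicator int) auto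
      show "(LINT x|lborel. ?v x) = 0"
        using box'[OF ab] by (simp add: set_lebesgue_integral_def)
      fix c d
      \<comment> \<open>Integrating the cut-off function over another box is integrating
        \<open>w'\<close> over the intersection, again a box. If nonempty, its closure
        \<open>cbox p q\<close> stays inside \<open>cbox a b\<close>, hence inside
        \<open>S\<close>.\<close>
      obtain p q where pq: "box a b \<inter> box c d = box p q" using box_Int_box by blast
      have "(LINT x:box c d|lborel. ?v x) = (LINT x:box p q|lborel. w' x)"
        unfolding set_lebesgue_integral_def pq[symmetric]
        by (intro Bochner_Integration.integral_cong) (auto simp: indicator_def)
      also have "\<dots> = 0"
      proof (cases "box p q = {}")
        case False
        then have "cbox p q = closure (box a b \<inter> box c d)" using closure_box[OF False] pq by simp
        also have "\<dots> \<subseteq> cbox a b" by (rule closure_minimal) (use box_subset_cbox in auto)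
        finally have "cbox p q \<subseteq> S" using ab by (rule order_trans)
        then show ?thesis by (rule box')
      qed (simp add: set_lebesgue_integral_def)
      finally show "(LINT x:box c d|lborel. ?v x) = 0" .
    qed
    then have "AE x in lebesgue. ?v x = 0" by (rule AE_completion)
    \<comment> \<open>The cut-off sees only the open box; the faces that remain are a null
      set.\<close>
    moreover have "AE x in lebesgue. x \<notin> cbox a b - box a b"
      by (rule AE_not_in) (simp add: negligible_frontier_interval flip: negligible_iff_null_sets)
    ultimately show ?thesis using eq by eventually_elim (auto simp: indicator_def split: if_splits)
  qed
  obtain D where D: "countable D" "D \<subseteq> Pow S" "\<And>X. X \<in> D \<Longrightarrow> \<exists>a b. X = cbox a b" "\<Union>D = S"
    using open_countable_Union_open_cbox[OF \<open>open S\<close>] by blast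
  have "AE x in lebesgue. \<forall>X\<in>D. x \<in> X \<longrightarrow> w x = 0"
  proof (rule AE_ball_countable'[OF _ D(1)])
    show "AE x in lebesgue. x \<in> X \<longrightarrow> w x = 0" if "X \<in> D" for X
      using D(2,3) that zero by blast
  qed
  then show ?thesis by eventually_elim (use D(4) in blast)
qed

lemma continuous_imp_measurable_lebesgue:
  fixes f :: "'a::euclidean_space \<Rightarrow> real"
  shows "continuous_on UNIV f \<Longrightarrow> f \<in> borel_measurable lebesgue"
  by (rule measurable_completion) (simp add: borel_measurable_continuous_onI)

text \<open>Bumps with values in [0, 1] converge pointwise to the indicator of a box, so dominated
  convergence with majorant \<open>\<bar>w x\<bar>\<close> passes from test functions to box
  integrals.\<close>

lemma fundamental_lemma_calculus_of_variations:
  assumes w: "integrable lebesgue w" and "open \<Omega>"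
    and test: "\<And>\<phi>. \<phi> \<in> test_functions \<Omega> \<Longrightarrow> (LINT x|lebesgue. w x * \<phi> x) = 0"
  shows "AE x in lebesgue. x \<in> \<Omega> \<longrightarrow> w x = 0"
proof (rule AE_0_on_open_if_box_integrals_0[OF w \<open>open \<Omega>\<close>])
  fix a b assume ab: "cbox a b \<subseteq> \<Omega>"
  have bump: "box_bump a b n \<in> test_functions \<Omega>" for n
    by (rule box_bump_test_function[OF ab])
  have meas: "box_bump a b n \<in> borel_measurable lebesgue" for n
    using bump[of n] C_k_imp_continuous
    by (intro continuous_imp_measurable_lebesgue) (auto simp: test_functions_def)
  have [measurable]: "w \<in> borel_measurable lebesgue" using w by simp
  have "(\<lambda>n. LINT x|lebesgue. w x * box_bump a b n x)
      \<longlonglongrightarrow> (LINT x|lebesgue. w x * indicator (box a b) x)"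
  proof (rule integral_dominated_convergence[where w = "\<lambda>x. \<bar>w x\<bar>"])
    show "AE x in lebesgue. (\<lambda>n. w x * box_bump a b n x) \<longlonglongrightarrow> w x * indicator (box a b) x"
      by (intro AE_I2 tendsto_mult tendsto_const box_bump_tendsto)
    show "AE x in lebesgue. norm (w x * box_bump a b n x) \<le> \<bar>w x\<bar>" for n
      using box_bump_bounds[of a b n] by (auto simp: abs_mult intro!: AE_I2 mult_left_le)
    show "(\<lambda>x. w x * indicator (box a b) x) \<in> borel_measurable lebesgue"
      by (intro borel_measurable_times borel_measurable_indicator) auto
    show "(\<lambda>x. w x * box_bump a b n x) \<in> borel_measurable lebesgue" for n
      by (intro borel_measurable_times meas) simp
  qed (use w in simp)
  then show "(LINT x:box a b|lebesgue. w x) = 0"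
    using test[OF bump]
    by (simp add: set_lebesgue_integral_def mult.commute LIMSEQ_const_iff)
qed

section \<open>The Hilbert structure of the Sobolev space\<close>

lemma abs_rep_aefun [simp]: "abs_aefun (rep_aefun u) = u"
  by (rule Quotient3_abs_rep[OF Quotient3_aefun])

lemma rep_abs_aefun_AE: "AE x in lebesgue. rep_aefun (abs_aefun f) x = f x"
  using aefun.abs_eq_iff[of "rep_aefun (abs_aefun f)" f] by (simp add: ae_eq_def)

lemma aefun_eqI: "(AE x in lebesgue. rep_aefun u x = rep_aefun v x) \<Longrightarrow> u = v"
  using aefun.abs_eq_iff[of "rep_aefun u" "rep_aefun v"] by (simp add: ae_eq_def)

lemma rep_aefun_zero_AE: "AE x in lebesgue. rep_aefun 0 x = 0"
  unfolding zero_aefun_def by (rule rep_abs_aefun_AE)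

lemma rep_aefun_add_AE: "AE x in lebesgue. rep_aefun (u + v) x = rep_aefun u x + rep_aefun v x"
  using rep_abs_aefun_AE[of "\<lambda>x. rep_aefun u x + rep_aefun v x"]
  by (simp flip: plus_aefun.abs_eq)

lemma rep_aefun_scaleR_AE: "AE x in lebesgue. rep_aefun (c *\<^sub>R u) x = c * rep_aefun u x"
  using rep_abs_aefun_AE[of "\<lambda>x. c * rep_aefun u x"]
  by (simp flip: scaleR_aefun.abs_eq)

lemma integrable_mult_of_squares:
  fixes f g :: "'a \<Rightarrow> real"
  assumes [measurable]: "f \<in> borel_measurable M" "g \<in> borel_measurable M"
    and "integrable M (\<lambda>x. (f x)\<^sup>2)" "integrable M (\<lambda>x. (g x)\<^sup>2)"
  shows "integrable M (\<lambda>x. f x * g x)"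
proof (rule Bochner_Integration.integrable_bound)
  show "integrable M (\<lambda>x. (f x)\<^sup>2 + (g x)\<^sup>2)" using assms by simp
  have "\<bar>s * t\<bar> \<le> s\<^sup>2 + t\<^sup>2" for s t :: real
  proof -
    have "0 \<le> (\<bar>s\<bar> - \<bar>t\<bar>)\<^sup>2" "0 \<le> \<bar>s\<bar> * \<bar>t\<bar>" by simp_all
    then show ?thesis unfolding power2_diff abs_mult power2_abs by linarith
  qed
  then show "AE x in M. norm (f x * g x) \<le> norm ((f x)\<^sup>2 + (g x)\<^sup>2)" by simp
qed simp

text \<open>Lets membership be checked on a convenient function instead of the chosen
  representative; completeness of \<open>lebesgue\<close> carries measurability across the null set
  where they differ.\<close>

lemma L2_spaceI:
  assumes f: "f \<in> borel_measurable lebesgue" and eq: "AE x in lebesgue. rep_aefun u x = f x"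
    and sq: "integrable lebesgue (\<lambda>x. (f x)\<^sup>2)"
    and off: "AE x in lebesgue. x \<notin> \<Omega> \<longrightarrow> f x = 0"
  shows "u \<in> L2_space \<Omega>"
proof -
  have u: "rep_aefun u \<in> borel_measurable lebesgue"
    by (rule borel_measurable_AE[OF f]) (use eq in eventually_elim, simp)
  have "integrable lebesgue (\<lambda>x. (rep_aefun u x)\<^sup>2)"
    by (rule integrable_cong_AE_imp[OF sq borel_measurable_power[OF u]])
       (use eq in eventually_elim, simp)
  moreover have "AE x in lebesgue. x \<notin> \<Omega> \<longrightarrow> rep_aefun u x = 0"
    using eq off by eventually_elim simp
  ultimately show ?thesis using u by (simp add: L2_space_def)
qed

lemma L2_spaceD:
  assumes "u \<in> L2_space \<Omega>"
  shows "rep_aefun u \<in> borel_measurable lebesgue"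
    and "integrable lebesgue (\<lambda>x. (rep_aefun u x)\<^sup>2)"
    and "AE x in lebesgue. x \<notin> \<Omega> \<longrightarrow> rep_aefun u x = 0"
  using assms by (auto simp: L2_space_def)

lemma integrable_L2_mult:
  "u \<in> L2_space \<Omega> \<Longrightarrow> v \<in> L2_space \<Omega> \<Longrightarrow> integrable lebesgue (\<lambda>x. rep_aefun u x * rep_aefun v x)"
  by (intro integrable_mult_of_squares L2_spaceD)

lemma subspace_L2_space: "subspace (L2_space \<Omega>)"
proof (rule subspaceI)
  show "0 \<in> L2_space \<Omega>"
    by (rule L2_spaceI[where f = "\<lambda>x. 0"]) (auto intro: rep_aefun_zero_AE)
next
  fix u v assume uv: "u \<in> L2_space \<Omega>" "v \<in> L2_space \<Omega>"
  show "u + v \<in> L2_space \<Omega>"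
  proof (rule L2_spaceI[OF _ rep_aefun_add_AE])
    show "(\<lambda>x. rep_aefun u x + rep_aefun v x) \<in> borel_measurable lebesgue"
      by (intro borel_measurable_add L2_spaceD[OF uv(1)] L2_spaceD[OF uv(2)])
    show "integrable lebesgue (\<lambda>x. (rep_aefun u x + rep_aefun v x)\<^sup>2)"
      using L2_spaceD(2)[OF uv(1)] L2_spaceD(2)[OF uv(2)] integrable_L2_mult[OF uv]
      by (simp add: power2_sum mult.assoc)
    show "AE x in lebesgue. x \<notin> \<Omega> \<longrightarrow> rep_aefun u x + rep_aefun v x = 0"
      using L2_spaceD(3)[OF uv(1)] L2_spaceD(3)[OF uv(2)] by eventually_elim simp
  qed
next
  fix c u assume u: "u \<in> L2_space \<Omega>"
  show "c *\<^sub>R u \<in> L2_space \<Omega>"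
  proof (rule L2_spaceI[OF _ rep_aefun_scaleR_AE])
    show "(\<lambda>x. c * rep_aefun u x) \<in> borel_measurable lebesgue"
      by (intro borel_measurable_times borel_measurable_const L2_spaceD[OF u])
    show "integrable lebesgue (\<lambda>x. (c * rep_aefun u x)\<^sup>2)"
      using L2_spaceD(2)[OF u] by (simp add: power_mult_distrib)
    show "AE x in lebesgue. x \<notin> \<Omega> \<longrightarrow> c * rep_aefun u x = 0"
      using L2_spaceD(3)[OF u] by eventually_elim simp
  qed
qed

lemma integral_rep_aefun_cong:
  assumes "AE x in lebesgue. rep_aefun u x = f x"
  shows "rep_aefun u \<in> borel_measurable lebesgue \<Longrightarrow> g \<in> borel_measurable lebesgue \<Longrightarrow>
    (LINT x|lebesgue. rep_aefun u x * g x) = (LINT x|lebesgue. f x * g x)"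
proof (rule integral_cong_AE)
  assume [measurable]: "rep_aefun u \<in> borel_measurable lebesgue" "g \<in> borel_measurable lebesgue"
  show "(\<lambda>x. rep_aefun u x * g x) \<in> borel_measurable lebesgue" by measurable
  have [measurable]: "f \<in> borel_measurable lebesgue"
    by (rule borel_measurable_AE[OF _ assms]) measurable
  show "(\<lambda>x. f x * g x) \<in> borel_measurable lebesgue" by measurable
  show "AE x in lebesgue. rep_aefun u x * g x = f x * g x"
    using assms by eventually_elim simp
qed

lemma L2_inner_commute: "L2_inner u v = L2_inner v u"
  by (simp add: L2_inner_def mult.commute)

lemma L2_inner_add_left:
  assumes "u \<in> L2_space \<Omega>" "v \<in> L2_space \<Omega>" "w \<in> L2_space \<Omega>"
  shows "L2_inner (u + v) w = L2_inner u w + L2_inner v w"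
proof -
  have "u + v \<in> L2_space \<Omega>" using assms subspace_L2_space subspace_add by blast
  then have "L2_inner (u + v) w = (LINT x|lebesgue. (rep_aefun u x + rep_aefun v x) * rep_aefun w x)"
    unfolding L2_inner_def
    by (intro integral_rep_aefun_cong rep_aefun_add_AE L2_spaceD(1)[OF assms(3)] L2_spaceD(1))
  also have "\<dots> = L2_inner u w + L2_inner v w"
    unfolding L2_inner_def distrib_right
    by (intro Bochner_Integration.integral_add integrable_L2_mult[OF assms(1,3)] integrable_L2_mult[OF assms(2,3)])
  finally show ?thesis .
qed

lemma L2_inner_scaleR_left:
  assumes "u \<in> L2_space \<Omega>" "w \<in> L2_space \<Omega>"
  shows "L2_inner (c *\<^sub>R u) w = c * L2_inner u w"
proof -
  have "c *\<^sub>R u \<in> L2_space \<Omega>" using assms subspace_L2_space subspace_scale by blast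
  then have "L2_inner (c *\<^sub>R u) w = (LINT x|lebesgue. c * rep_aefun u x * rep_aefun w x)"
    unfolding L2_inner_def
    by (intro integral_rep_aefun_cong rep_aefun_scaleR_AE L2_spaceD(1)[OF assms(2)] L2_spaceD(1))
  then show ?thesis by (simp add: L2_inner_def mult.assoc)
qed

lemma L2_inner_self_nonneg: "0 \<le> L2_inner u u"
  by (simp add: L2_inner_def)

lemma L2_inner_self_eq_0:
  assumes "u \<in> L2_space \<Omega>" "L2_inner u u = 0"
  shows "u = 0"
proof (rule aefun_eqI)
  have "AE x in lebesgue. rep_aefun u x * rep_aefun u x = 0"
    using assms(2) unfolding L2_inner_def
    by (subst (asm) integral_nonneg_eq_0_iff_AE[OF integrable_L2_mult[OF assms(1,1)]]) auto
  then show "AE x in lebesgue. rep_aefun u x = rep_aefun 0 x"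
    using rep_aefun_zero_AE by eventually_elim simp
qed

text \<open>Boundedness of \<open>\<Omega>\<close> enters here: \<open>\<psi>\<close> is bounded on
  the compact closure, \<open>u\<close> vanishes almost everywhere off \<open>\<Omega>\<close>, and
  \<open>\<bar>t\<bar> \<le> t^2 + 1\<close> gives an integrable majorant. It covers test functions,
  their partial derivatives and the constant 1.\<close>

lemma integrable_L2_mult_continuous:
  assumes "bounded \<Omega>" and u: "u \<in> L2_space \<Omega>" and \<psi>: "continuous_on UNIV \<psi>"
  shows "integrable lebesgue (\<lambda>x. rep_aefun u x * \<psi> x)"
proof -
  have K: "compact (closure \<Omega>)" using \<open>bounded \<Omega>\<close> by simp
  then have "compact (\<psi> ` closure \<Omega>)"
    using \<psi> continuous_on_subset by (intro compact_continuous_image) blast+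
  then obtain B where B: "\<And>x. x \<in> closure \<Omega> \<Longrightarrow> \<bar>\<psi> x\<bar> \<le> B"
    using compact_imp_bounded bounded_iff by (metis image_eqI real_norm_def)
  have int: "integrable lebesgue (\<lambda>x. B * ((rep_aefun u x)\<^sup>2 + indicator (closure \<Omega>) x))"
    using L2_spaceD(2)[OF u] lmeasurable_compact[OF K]
    by (intro integrable_mult_right Bochner_Integration.integrable_add)
       (auto simp: fmeasurable_def)
  show ?thesis
  proof (rule Bochner_Integration.integrable_bound[OF int])
    show "(\<lambda>x. rep_aefun u x * \<psi> x) \<in> borel_measurable lebesgue"
      using continuous_imp_measurable_lebesgue[OF \<psi>]
      by (intro borel_measurable_times L2_spaceD(1)[OF u]) auto
    show "AE x in lebesgue. norm (rep_aefun u x * \<psi> x)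
        \<le> norm (B * ((rep_aefun u x)\<^sup>2 + indicator (closure \<Omega>) x))"
      using L2_spaceD(3)[OF u]
    proof eventually_elim
      case (elim x)
      show ?case
      proof (cases "x \<in> \<Omega>")
        case True
        then have x: "x \<in> closure \<Omega>" using closure_subset by blast
        have "0 \<le> B" using B[OF x] by simp
        have "\<bar>t\<bar> \<le> t\<^sup>2 + 1" for t :: real
        proof -
          have "0 \<le> (\<bar>t\<bar> - 1)\<^sup>2" "0 \<le> \<bar>t\<bar>" by simp_all
          then show ?thesis unfolding power2_diff power2_abs by simp
        qed
        then have "\<bar>rep_aefun u x\<bar> * \<bar>\<psi> x\<bar> \<le> ((rep_aefun u x)\<^sup>2 + 1) * B"
          using B[OF x] by (intro mult_mono) auto
        then show ?thesis using x \<open>0 \<le> B\<close> by (simp add: abs_mult mult.commute)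
      qed (use elim in simp)
    qed
  qed
qed

section \<open>Weak derivatives on a bounded open set\<close>

locale bounded_open_plane_set =
  fixes \<Omega> :: "plane set"
  assumes open_\<Omega>: "open \<Omega>" and bounded_\<Omega>: "bounded \<Omega>"
begin

lemma test_function_continuous:
  assumes "\<phi> \<in> test_functions \<Omega>"
  shows "continuous_on UNIV \<phi>" "continuous_on UNIV (partial i \<phi>)"
proof -
  have "C_k k \<phi>" for k using assms by (simp add: test_functions_def)
  from this[of 0] this[of "Suc 0"]
  show "continuous_on UNIV \<phi>" "continuous_on UNIV (partial i \<phi>)" by simp_all
qed

lemma has_weak_partial_unique:
  assumes g: "has_weak_partial \<Omega> i u g" and h: "has_weak_partial \<Omega> i u h"
  shows "g = h"
proof (rule aefun_eqI)
  have L2: "g \<in> L2_space \<Omega>" "h \<in> L2_space \<Omega>" using g h by (auto simp: has_weak_partial_def)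
  have int: "integrable lebesgue (\<lambda>x. rep_aefun g x * \<psi> x)" "integrable lebesgue (\<lambda>x. rep_aefun h x * \<psi> x)"
    if "continuous_on UNIV \<psi>" for \<psi>
    using integrable_L2_mult_continuous[OF bounded_\<Omega> _ that] L2 by auto
  have "AE x in lebesgue. x \<in> \<Omega> \<longrightarrow> rep_aefun g x - rep_aefun h x = 0"
  proof (rule fundamental_lemma_calculus_of_variations[OF _ open_\<Omega>])
    show "integrable lebesgue (\<lambda>x. rep_aefun g x - rep_aefun h x)"
      \<comment> \<open>Testing with the constant 1 shows that \<open>g\<close> and \<open>h\<close>
        are themselves integrable, as the fundamental lemma demands of their difference.\<close>
      using int[of "\<lambda>x. 1"] by simp
    fix \<phi> assume \<phi>: "\<phi> \<in> test_functions \<Omega>"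
    have "(LINT x|lebesgue. rep_aefun g x * \<phi> x) = (LINT x|lebesgue. rep_aefun h x * \<phi> x)"
    proof -
      have "- (LINT x|lebesgue. rep_aefun g x * \<phi> x) = - (LINT x|lebesgue. rep_aefun h x * \<phi> x)"
        using g h \<phi> unfolding has_weak_partial_def by (auto dest!: bspec)
      then show ?thesis by simp
    qed
    then show "(LINT x|lebesgue. (rep_aefun g x - rep_aefun h x) * \<phi> x) = 0"
      using int[OF test_function_continuous(1)[OF \<phi>]] by (simp add: left_diff_distrib)
  qed
  then show "AE x in lebesgue. rep_aefun g x = rep_aefun h x"
    using L2_spaceD(3)[OF L2(1)] L2_spaceD(3)[OF L2(2)] by eventually_elim auto
qed

text \<open>Uniqueness makes the definite description computable: any verified candidate is its
  value.\<close>

lemma weak_partial_eq: "has_weak_partial \<Omega> i u g \<Longrightarrow> weak_partial \<Omega> i u = g"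
  unfolding weak_partial_def using has_weak_partial_unique by blast

lemma has_weak_partial_zero: "has_weak_partial \<Omega> i 0 0"
proof -
  have "(LINT x|lebesgue. rep_aefun 0 x * f x) = 0" for f :: "plane \<Rightarrow> real"
  proof (rule integral_eq_zero_AE)
    show "AE x in lebesgue. rep_aefun 0 x * f x = 0"
      using rep_aefun_zero_AE by eventually_elim simp
  qed
  then show ?thesis
    using subspace_0[OF subspace_L2_space] by (simp add: has_weak_partial_def)
qed

lemma integral_L2_add_mult:
  assumes "u \<in> L2_space \<Omega>" "v \<in> L2_space \<Omega>" "continuous_on UNIV \<psi>"
  shows "(LINT x|lebesgue. rep_aefun (u + v) x * \<psi> x)
    = (LINT x|lebesgue. rep_aefun u x * \<psi> x) + (LINT x|lebesgue. rep_aefun v x * \<psi> x)"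
proof -
  have "u + v \<in> L2_space \<Omega>" using assms subspace_L2_space subspace_add by blast
  then have "(LINT x|lebesgue. rep_aefun (u + v) x * \<psi> x)
      = (LINT x|lebesgue. (rep_aefun u x + rep_aefun v x) * \<psi> x)"
    by (rule integral_rep_aefun_cong[OF rep_aefun_add_AE L2_spaceD(1)
          continuous_imp_measurable_lebesgue[OF assms(3)]])
  then show ?thesis
    using integrable_L2_mult_continuous[OF bounded_\<Omega> assms(1,3)]
      integrable_L2_mult_continuous[OF bounded_\<Omega> assms(2,3)]
    by (simp add: distrib_right)
qed

lemma integral_L2_scaleR_mult:
  assumes "u \<in> L2_space \<Omega>" "continuous_on UNIV \<psi>"
  shows "(LINT x|lebesgue. rep_aefun (c *\<^sub>R u) x * \<psi> x) = c * (LINT x|lebesgue. rep_aefun u x * \<psi> x)"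
proof -
  have "c *\<^sub>R u \<in> L2_space \<Omega>" using assms subspace_L2_space subspace_scale by blast
  then have "(LINT x|lebesgue. rep_aefun (c *\<^sub>R u) x * \<psi> x) = (LINT x|lebesgue. c * rep_aefun u x * \<psi> x)"
    by (rule integral_rep_aefun_cong[OF rep_aefun_scaleR_AE L2_spaceD(1)
          continuous_imp_measurable_lebesgue[OF assms(2)]])
  then show ?thesis by (simp add: mult.assoc)
qed

lemma has_weak_partial_add:
  assumes "u \<in> L2_space \<Omega>" "v \<in> L2_space \<Omega>" "has_weak_partial \<Omega> i u g" "has_weak_partial \<Omega> i v h"
  shows "has_weak_partial \<Omega> i (u + v) (g + h)"
  using assms subspace_add[OF subspace_L2_space]
  by (auto simp: has_weak_partial_def integral_L2_add_mult test_function_continuous)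

lemma has_weak_partial_scaleR:
  assumes "u \<in> L2_space \<Omega>" "has_weak_partial \<Omega> i u g"
  shows "has_weak_partial \<Omega> i (c *\<^sub>R u) (c *\<^sub>R g)"
  using assms subspace_scale[OF subspace_L2_space]
  by (auto simp: has_weak_partial_def integral_L2_scaleR_mult test_function_continuous)

section \<open>The space \<open>H1\<close> and its inner product\<close>

lemma H1_imp_L2: "u \<in> H1 \<Omega> \<Longrightarrow> u \<in> L2_space \<Omega>"
  by (simp add: H1_def)

lemma H1_has_weak_partial: "u \<in> H1 \<Omega> \<Longrightarrow> has_weak_partial \<Omega> i u (weak_partial \<Omega> i u)"
  using weak_partial_eq by (fastforce simp: H1_def)

lemma weak_partial_L2: "u \<in> H1 \<Omega> \<Longrightarrow> weak_partial \<Omega> i u \<in> L2_space \<Omega>"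
  using H1_has_weak_partial has_weak_partial_def by blast

lemma weak_partial_add:
  "u \<in> H1 \<Omega> \<Longrightarrow> v \<in> H1 \<Omega> \<Longrightarrow> weak_partial \<Omega> i (u + v) = weak_partial \<Omega> i u + weak_partial \<Omega> i v"
  by (intro weak_partial_eq has_weak_partial_add H1_has_weak_partial H1_imp_L2)

lemma weak_partial_scaleR:
  "u \<in> H1 \<Omega> \<Longrightarrow> weak_partial \<Omega> i (c *\<^sub>R u) = c *\<^sub>R weak_partial \<Omega> i u"
  by (intro weak_partial_eq has_weak_partial_scaleR H1_has_weak_partial H1_imp_L2)

lemma subspace_H1: "subspace (H1 \<Omega>)"
proof (rule subspaceI)
  show "0 \<in> H1 \<Omega>"
    using subspace_0[OF subspace_L2_space] has_weak_partial_zero by (auto simp: H1_def)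
  show "u + v \<in> H1 \<Omega>" if "u \<in> H1 \<Omega>" "v \<in> H1 \<Omega>" for u v
    using that subspace_add[OF subspace_L2_space] has_weak_partial_add unfolding H1_def by blast
  show "c *\<^sub>R u \<in> H1 \<Omega>" if "u \<in> H1 \<Omega>" for c u
    using that subspace_scale[OF subspace_L2_space] has_weak_partial_scaleR unfolding H1_def by blast
qed

lemma H1_inner_commute: "H1_inner \<Omega> u v = H1_inner \<Omega> v u"
  by (simp add: H1_inner_def L2_inner_commute)

lemma H1_inner_add_left:
  assumes "u \<in> H1 \<Omega>" "v \<in> H1 \<Omega>" "w \<in> H1 \<Omega>"
  shows "H1_inner \<Omega> (u + v) w = H1_inner \<Omega> u w + H1_inner \<Omega> v w"
  using assms
  by (simp add: H1_inner_def weak_partial_add sum.distrib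
      L2_inner_add_left[OF H1_imp_L2 H1_imp_L2 H1_imp_L2]
      L2_inner_add_left[OF weak_partial_L2 weak_partial_L2 weak_partial_L2])

lemma H1_inner_scaleR_left:
  assumes "u \<in> H1 \<Omega>" "w \<in> H1 \<Omega>"
  shows "H1_inner \<Omega> (c *\<^sub>R u) w = c * H1_inner \<Omega> u w"
  using assms
  by (simp add: H1_inner_def weak_partial_scaleR sum_distrib_left distrib_left
      L2_inner_scaleR_left[OF H1_imp_L2 H1_imp_L2]
      L2_inner_scaleR_left[OF weak_partial_L2 weak_partial_L2])

lemma H1_inner_self_nonneg: "0 \<le> H1_inner \<Omega> u u"
  by (simp add: H1_inner_def L2_inner_self_nonneg sum_nonneg)

lemma H1_norm_nonneg: "0 \<le> H1_norm \<Omega> u"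
  by (simp add: H1_norm_def H1_inner_self_nonneg)

lemma H1_norm_sq: "(H1_norm \<Omega> u)\<^sup>2 = H1_inner \<Omega> u u"
  by (simp add: H1_norm_def H1_inner_self_nonneg)

lemma H1_norm_eq_0:
  assumes "u \<in> H1 \<Omega>" "H1_norm \<Omega> u = 0"
  shows "u = 0"
proof (rule L2_inner_self_eq_0[OF H1_imp_L2[OF assms(1)]])
  have "L2_inner u u + (\<Sum>i\<in>UNIV. L2_inner (weak_partial \<Omega> i u) (weak_partial \<Omega> i u)) = 0"
    using assms(2) H1_norm_sq[of u] by (simp add: H1_inner_def)
  moreover have "0 \<le> (\<Sum>i\<in>UNIV. L2_inner (weak_partial \<Omega> i u) (weak_partial \<Omega> i u))"
    by (intro sum_nonneg L2_inner_self_nonneg)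
  ultimately show "L2_inner u u = 0" using L2_inner_self_nonneg[of u] by linarith
qed

lemma H1_norm_scaleR: "u \<in> H1 \<Omega> \<Longrightarrow> H1_norm \<Omega> (c *\<^sub>R u) = \<bar>c\<bar> * H1_norm \<Omega> u"
proof -
  assume u: "u \<in> H1 \<Omega>"
  then have "c *\<^sub>R u \<in> H1 \<Omega>" using subspace_H1 subspace_scale by blast
  with u have "H1_inner \<Omega> (c *\<^sub>R u) (c *\<^sub>R u) = c * H1_inner \<Omega> u (c *\<^sub>R u)"
    by (rule H1_inner_scaleR_left)
  also have "H1_inner \<Omega> u (c *\<^sub>R u) = c * H1_inner \<Omega> u u"
    using u by (subst H1_inner_commute) (rule H1_inner_scaleR_left)
  finally have "H1_inner \<Omega> (c *\<^sub>R u) (c *\<^sub>R u) = c\<^sup>2 * H1_inner \<Omega> u u"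
    by (simp add: power2_eq_square)
  then show ?thesis by (simp add: H1_norm_def real_sqrt_mult)
qed

lemma H1_norm_zero: "H1_norm \<Omega> 0 = 0"
  using H1_norm_scaleR[OF subspace_0[OF subspace_H1], of 0] by simp

lemma H1_inner_sum_left:
  assumes "finite K" "\<And>k. k \<in> K \<Longrightarrow> f k \<in> H1 \<Omega>" "w \<in> H1 \<Omega>"
  shows "H1_inner \<Omega> (\<Sum>k\<in>K. f k) w = (\<Sum>k\<in>K. H1_inner \<Omega> (f k) w)"
  using assms
proof (induction K rule: finite_induct)
  case empty
  have "H1_inner \<Omega> (0 *\<^sub>R 0) w = 0 * H1_inner \<Omega> 0 w"
    by (rule H1_inner_scaleR_left[OF subspace_0[OF subspace_H1] \<open>w \<in> H1 \<Omega>\<close>])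
  then show ?case by simp
next
  case (insert k K)
  have f: "f k \<in> H1 \<Omega>" "(\<Sum>k\<in>K. f k) \<in> H1 \<Omega>"
    using insert.prems(1) by (auto intro: subspace_sum[OF subspace_H1])
  have "H1_inner \<Omega> (\<Sum>k\<in>K. f k) w = (\<Sum>k\<in>K. H1_inner \<Omega> (f k) w)"
    using insert.IH insert.prems by blast
  then show ?case
    using insert.hyps H1_inner_add_left[OF f insert.prems(2)] by simp
qed

text \<open>Pythagoras: expanding both slots of the inner product leaves only the diagonal
  terms.\<close>

lemma H1_norm_sum_orthogonal:
  assumes "finite K" "\<And>k. k \<in> K \<Longrightarrow> f k \<in> H1 \<Omega>"
    and orth: "\<And>k l. k \<in> K \<Longrightarrow> l \<in> K \<Longrightarrow> k \<noteq> l \<Longrightarrow> H1_inner \<Omega> (f k) (f l) = 0"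
  shows "(H1_norm \<Omega> (\<Sum>k\<in>K. f k))\<^sup>2 = (\<Sum>k\<in>K. (H1_norm \<Omega> (f k))\<^sup>2)"
proof -
  have sum: "(\<Sum>k\<in>K. f k) \<in> H1 \<Omega>" by (rule subspace_sum[OF subspace_H1 assms(2)])
  have "H1_inner \<Omega> (f k) (\<Sum>l\<in>K. f l) = H1_inner \<Omega> (f k) (f k)" if k: "k \<in> K" for k
  proof -
    have "H1_inner \<Omega> (f k) (\<Sum>l\<in>K. f l) = (\<Sum>l\<in>K. H1_inner \<Omega> (f l) (f k))"
      using assms(1,2) k by (subst H1_inner_commute) (rule H1_inner_sum_left)
    also have "\<dots> = (\<Sum>l\<in>K. if l = k then H1_inner \<Omega> (f k) (f k) else 0)"
      using orth k by (intro sum.cong) auto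
    finally show ?thesis using k \<open>finite K\<close> by simp
  qed
  then have "(\<Sum>k\<in>K. H1_inner \<Omega> (f k) (\<Sum>l\<in>K. f l)) = (\<Sum>k\<in>K. H1_inner \<Omega> (f k) (f k))"
    by (rule sum.cong[OF refl])
  moreover have "H1_inner \<Omega> (\<Sum>k\<in>K. f k) (\<Sum>l\<in>K. f l) = (\<Sum>k\<in>K. H1_inner \<Omega> (f k) (\<Sum>l\<in>K. f l))"
    using assms(2) by (rule H1_inner_sum_left[OF assms(1) _ sum])
  ultimately show ?thesis by (simp only: H1_norm_sq)
qed

end

section \<open>Dual norms and the localized estimator\<close>

lemma linear_map_on_zero: "subspace S \<Longrightarrow> linear_map_on S g \<Longrightarrow> g 0 = 0"
  unfolding linear_map_on_def by (metis scaleR_zero_left subspace_0)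

lemma linear_map_on_scaleR: "linear_map_on S g \<Longrightarrow> x \<in> S \<Longrightarrow> g (c *\<^sub>R x) = c *\<^sub>R g x"
  by (simp add: linear_map_on_def)

lemma linear_map_on_add: "linear_map_on S g \<Longrightarrow> x \<in> S \<Longrightarrow> y \<in> S \<Longrightarrow> g (x + y) = g x + g y"
  by (simp add: linear_map_on_def)

lemma linear_map_on_diff:
  assumes "subspace S" "linear_map_on S g" "x \<in> S" "y \<in> S"
  shows "g (x - y) = g x - g y"
proof -
  have "g (x - y) + g y = g x"
    using linear_map_on_add[OF assms(2) subspace_diff[OF assms(1,3,4)] assms(4)] by simp
  then show ?thesis by (simp add: eq_diff_eq)
qed

lemma linear_map_on_sum:
  assumes "subspace S" "linear_map_on S g" "finite K" "\<And>k. k \<in> K \<Longrightarrow> f k \<in> S"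
  shows "g (\<Sum>k\<in>K. f k) = (\<Sum>k\<in>K. g (f k))"
  using assms(3,4)
proof (induction K rule: finite_induct)
  case empty
  show ?case using linear_map_on_zero[OF assms(1,2)] by simp
next
  case (insert k K)
  have "f k \<in> S" "(\<Sum>k\<in>K. f k) \<in> S"
    using insert.prems by (auto intro: subspace_sum[OF assms(1)])
  moreover have "g (\<Sum>k\<in>K. f k) = (\<Sum>k\<in>K. g (f k))"
    using insert.IH insert.prems by blast
  ultimately show ?case
    using insert.hyps linear_map_on_add[OF assms(2)] by simp
qed

lemma linear_map_on_subset: "linear_map_on S g \<Longrightarrow> T \<subseteq> S \<Longrightarrow> linear_map_on T g"
  unfolding linear_map_on_def by blast

text \<open>The suprema need not be attained. For every \<open>k\<close> a sequence within
  \<open>inverse (real (Suc n))\<close> of the supremum is chosen; the bound \<open>M\<close> holds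
  for each \<open>n\<close> and survives the limit, which also passes through the squares whatever
  the signs.\<close>

lemma sum_SUP_squares_le:
  fixes g :: "'i \<Rightarrow> 'a \<Rightarrow> real"
  assumes "finite K" and ne: "\<And>k. k \<in> K \<Longrightarrow> S k \<noteq> {}" and bdd: "\<And>k. k \<in> K \<Longrightarrow> bdd_above (g k ` S k)"
    and le: "\<And>x. (\<And>k. k \<in> K \<Longrightarrow> x k \<in> S k) \<Longrightarrow> (\<Sum>k\<in>K. (g k (x k))\<^sup>2) \<le> M"
  shows "(\<Sum>k\<in>K. (SUP x\<in>S k. g k x)\<^sup>2) \<le> M"
proof -
  let ?N = "\<lambda>k. SUP x\<in>S k. g k x"
  have "\<exists>x. x \<in> S k \<and> ?N k - inverse (real (Suc n)) < g k x" if "k \<in> K" for k n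
  proof -
    have "?N k - inverse (real (Suc n)) < ?N k" by simp
    then show ?thesis using less_cSUP_iff[OF ne[OF that] bdd[OF that]] by blast
  qed
  then obtain x where x: "\<And>k n. k \<in> K \<Longrightarrow> x k n \<in> S k"
      "\<And>k n. k \<in> K \<Longrightarrow> ?N k - inverse (real (Suc n)) < g k (x k n)"
    by metis
  have "(\<lambda>n. g k (x k n)) \<longlonglongrightarrow> ?N k" if k: "k \<in> K" for k
  proof (rule tendsto_sandwich[OF _ _ _ tendsto_const])
    show "eventually (\<lambda>n. ?N k - inverse (real (Suc n)) \<le> g k (x k n)) sequentially"
      using x(2)[OF k] by (intro always_eventually allI less_imp_le)
    show "eventually (\<lambda>n. g k (x k n) \<le> ?N k) sequentially"
      using x(1)[OF k] bdd[OF k] by (intro always_eventually allI cSUP_upper)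
    show "(\<lambda>n. ?N k - inverse (real (Suc n))) \<longlonglongrightarrow> ?N k"
      using tendsto_diff[OF tendsto_const LIMSEQ_inverse_real_of_nat] by simp
  qed
  then have "(\<lambda>n. \<Sum>k\<in>K. (g k (x k n))\<^sup>2) \<longlonglongrightarrow> (\<Sum>k\<in>K. (?N k)\<^sup>2)"
    by (intro tendsto_sum tendsto_power)
  then show ?thesis
  proof (rule LIMSEQ_le_const2)
    show "\<exists>m. \<forall>n\<ge>m. (\<Sum>k\<in>K. (g k (x k n))\<^sup>2) \<le> M"
      using x(1) by (intro exI allI impI le)
  qed
qed

section \<open>Dual norms and the stability constant\<close>

context bounded_open_plane_set
begin

text \<open>Makes the \<open>SUP\<close> in \<open>dual_norm\<close> a genuine least upper bound.
  The bound is \<open>\<bar>C\<bar>\<close> because on the zero space the continuity constant may be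
  negative.\<close>

lemma dual_space_bdd_above:
  assumes "g \<in> dual_space \<Omega> S"
  shows "bdd_above ((\<lambda>v. \<bar>g v\<bar>) ` {v \<in> S. H1_norm \<Omega> v \<le> 1})"
proof -
  obtain C where C: "\<And>v. v \<in> S \<Longrightarrow> \<bar>g v\<bar> \<le> C * H1_norm \<Omega> v"
    using assms by (auto simp: dual_space_def)
  have "\<bar>g v\<bar> \<le> \<bar>C\<bar>" if "v \<in> S" "H1_norm \<Omega> v \<le> 1" for v
  proof -
    have "C * H1_norm \<Omega> v \<le> \<bar>C\<bar> * H1_norm \<Omega> v"
      by (intro mult_right_mono H1_norm_nonneg) simp
    also have "\<dots> \<le> \<bar>C\<bar> * 1" using that by (intro mult_left_mono) auto
    finally show ?thesis using C[OF that(1)] by simp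
  qed
  then show ?thesis by (intro bdd_aboveI2[where M = "\<bar>C\<bar>"]) simp
qed

lemma unit_ball_nonempty: "subspace S \<Longrightarrow> {v \<in> S. H1_norm \<Omega> v \<le> 1} \<noteq> {}"
  using subspace_0[of S] H1_norm_zero by auto

lemma dual_norm_nonneg:
  assumes "subspace S" "g \<in> dual_space \<Omega> S"
  shows "0 \<le> dual_norm \<Omega> S g"
  unfolding dual_norm_def
  by (rule cSUP_upper2[OF dual_space_bdd_above[OF assms(2)], of 0])
     (use subspace_0[OF assms(1)] H1_norm_zero in auto)

text \<open>Scale \<open>v\<close> to norm 1; for norm 0, definiteness of the \<open>H1\<close> norm
  forces \<open>v = 0\<close>.\<close>

lemma le_dual_norm:
  assumes S: "subspace S" "S \<subseteq> H1 \<Omega>" and g: "g \<in> dual_space \<Omega> S" and v: "v \<in> S"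
  shows "\<bar>g v\<bar> \<le> dual_norm \<Omega> S g * H1_norm \<Omega> v"
proof (cases "H1_norm \<Omega> v = 0")
  case True
  then have "v = 0" using H1_norm_eq_0 v S by blast
  then have "g v = 0" using linear_map_on_zero[OF S(1), of g] g by (simp add: dual_space_def)
  then show ?thesis using True by simp
next
  case False
  define n where "n = H1_norm \<Omega> v"
  have n: "n > 0" using False H1_norm_nonneg[of v] by (simp add: n_def)
  have "v \<in> H1 \<Omega>" using v S by blast
  then have "H1_norm \<Omega> (inverse n *\<^sub>R v) = \<bar>inverse n\<bar> * n"
    unfolding n_def by (rule H1_norm_scaleR)
  then have "H1_norm \<Omega> (inverse n *\<^sub>R v) = 1" using n by simp
  then have "\<bar>g (inverse n *\<^sub>R v)\<bar> \<le> dual_norm \<Omega> S g"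
    unfolding dual_norm_def using subspace_scale[OF S(1) v]
    by (intro cSUP_upper dual_space_bdd_above[OF g]) auto
  moreover have "g (inverse n *\<^sub>R v) = inverse n * g v"
    using g v by (simp add: dual_space_def linear_map_on_def)
  ultimately have "\<bar>g v\<bar> / n \<le> dual_norm \<Omega> S g"
    using n by (simp add: abs_mult divide_inverse mult.commute)
  then show ?thesis using n by (simp add: n_def[symmetric] pos_divide_le_eq)
qed

text \<open>For the residual, the annihilation of \<open>T\<close> is Galerkin orthogonality.\<close>

lemma dual_norm_annihilator_bound:
  assumes S: "subspace S" "S \<subseteq> H1 \<Omega>" and g: "g \<in> dual_space \<Omega> S" and v: "v \<in> S"
    and T: "T \<subseteq> S" "T \<noteq> {}" "\<And>w. w \<in> T \<Longrightarrow> g w = 0"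
  shows "\<bar>g v\<bar> \<le> dual_norm \<Omega> S g * sqrt (INF w\<in>T. (H1_norm \<Omega> (v - w))\<^sup>2)"
proof -
  let ?N = "dual_norm \<Omega> S g" and ?I = "INF w\<in>T. (H1_norm \<Omega> (v - w))\<^sup>2"
  have lin: "linear_map_on S g" using g by (simp add: dual_space_def)
  have le: "\<bar>g v\<bar> \<le> ?N * H1_norm \<Omega> (v - w)" if "w \<in> T" for w
  proof -
    have w: "w \<in> S" using T that by blast
    have "g (v - w) = g v"
      using linear_map_on_diff[OF S(1) lin v w] T(3)[OF that] by simp
    then show ?thesis using le_dual_norm[OF S g subspace_diff[OF S(1) v w]] by simp
  qed
  show ?thesis
  \<comment> \<open>A positive \<open>?N\<close> can be divided out, which makes
    \<open>\<bar>g v\<bar> / ?N\<close> a lower bound for every distance and so for their infimum.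
    If it is 0, then \<open>le\<close> already gives \<open>g v = 0\<close>.\<close>
  proof (cases "?N = 0")
    case True
    then show ?thesis using le T(2) by auto
  next
    case False
    then have N: "?N > 0" using dual_norm_nonneg[OF S(1) g] by simp
    have "(\<bar>g v\<bar> / ?N)\<^sup>2 \<le> ?I"
    proof (rule cINF_greatest[OF T(2)])
      show "(\<bar>g v\<bar> / ?N)\<^sup>2 \<le> (H1_norm \<Omega> (v - w))\<^sup>2" if "w \<in> T" for w
        using le[OF that] N by (intro power_mono) (auto simp: pos_divide_le_eq mult.commute)
    qed
    then have "\<bar>g v\<bar> / ?N \<le> sqrt ?I" by (rule real_le_rsqrt)
    then show ?thesis using N by (simp add: pos_divide_le_eq mult.commute)
  qed
qed

text \<open>Both claims rest on the quotients in \<open>c_pu\<close> being bounded above. The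
  competitor 0 in \<open>Vt \<inter> Os k\<close> bounds each infimum by the squared norm of
  \<open>P k \<phi>\<close>, and continuity of the \<open>P k\<close> with constants
  \<open>C k\<close> bounds the quotient by the root of the sum of the
  \<open>(C k)^2\<close>.\<close>

lemma
  assumes Vh: "subspace Vh" "Vh \<subseteq> H1 \<Omega>" and Vt: "subspace Vt" and K: "finite K"
    and Os: "\<And>k. k \<in> K \<Longrightarrow> subspace (Os k)"
    and P: "\<And>k. k \<in> K \<Longrightarrow> continuous_linear_map \<Omega> Vh (Os k) (P k)"
  shows c_pu_nonneg: "0 \<le> c_pu \<Omega> Vh Vt K Os P"
    and le_c_pu: "\<phi> \<in> Vh \<Longrightarrow> sqrt (\<Sum>k\<in>K. INF \<psi>\<in>Vt \<inter> Os k. (H1_norm \<Omega> (P k \<phi> - \<psi>))\<^sup>2)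
      \<le> c_pu \<Omega> Vh Vt K Os P * H1_norm \<Omega> \<phi>"
proof -
  let ?s = "\<lambda>\<phi>. sqrt (\<Sum>k\<in>K. INF \<psi>\<in>Vt \<inter> Os k. (H1_norm \<Omega> (P k \<phi> - \<psi>))\<^sup>2)"
  have "\<forall>k\<in>K. \<exists>C. \<forall>v\<in>Vh. H1_norm \<Omega> (P k v) \<le> C * H1_norm \<Omega> v"
    using P by (auto simp: continuous_linear_map_def)
  then obtain C where C: "\<And>k v. k \<in> K \<Longrightarrow> v \<in> Vh \<Longrightarrow> H1_norm \<Omega> (P k v) \<le> C k * H1_norm \<Omega> v"
    by metis
  have bound: "?s \<phi> \<le> sqrt (\<Sum>k\<in>K. (C k)\<^sup>2) * H1_norm \<Omega> \<phi>" if \<phi>: "\<phi> \<in> Vh" for \<phi>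
  proof -
    have "(INF \<psi>\<in>Vt \<inter> Os k. (H1_norm \<Omega> (P k \<phi> - \<psi>))\<^sup>2) \<le> (C k)\<^sup>2 * (H1_norm \<Omega> \<phi>)\<^sup>2"
      if k: "k \<in> K" for k
    proof -
      have "0 \<in> Vt \<inter> Os k" using subspace_0[OF Vt] subspace_0[OF Os[OF k]] by simp
      moreover have "bdd_below ((\<lambda>\<psi>. (H1_norm \<Omega> (P k \<phi> - \<psi>))\<^sup>2) ` (Vt \<inter> Os k))"
        by (rule bdd_belowI2[where m = 0]) simp
      ultimately have "(INF \<psi>\<in>Vt \<inter> Os k. (H1_norm \<Omega> (P k \<phi> - \<psi>))\<^sup>2) \<le> (H1_norm \<Omega> (P k \<phi> - 0))\<^sup>2"
        by (rule cINF_lower[rotated])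
      also have "\<dots> \<le> (C k * H1_norm \<Omega> \<phi>)\<^sup>2"
        using C[OF k \<phi>] H1_norm_nonneg by (intro power_mono) simp_all
      finally show ?thesis by (simp add: power_mult_distrib)
    qed
    then have "?s \<phi> \<le> sqrt (\<Sum>k\<in>K. (C k)\<^sup>2 * (H1_norm \<Omega> \<phi>)\<^sup>2)"
      by (intro real_sqrt_le_mono sum_mono)
    also have "\<dots> = sqrt (\<Sum>k\<in>K. (C k)\<^sup>2) * H1_norm \<Omega> \<phi>"
      using H1_norm_nonneg[of \<phi>] by (simp add: real_sqrt_mult flip: sum_distrib_right)
    finally show ?thesis .
  qed
  let ?Q = "insert 0 ((\<lambda>\<phi>. ?s \<phi> / H1_norm \<Omega> \<phi>) ` (Vh - {0}))"
  have pos: "H1_norm \<Omega> \<phi> > 0" if "\<phi> \<in> Vh - {0}" for \<phi>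
    using that Vh(2) H1_norm_eq_0[of \<phi>] H1_norm_nonneg[of \<phi>] by force
  have "?s \<phi> / H1_norm \<Omega> \<phi> \<le> sqrt (\<Sum>k\<in>K. (C k)\<^sup>2)" if "\<phi> \<in> Vh - {0}" for \<phi>
    using bound[of \<phi>] pos[OF that] that by (simp add: pos_divide_le_eq)
  then have bdd: "bdd_above ?Q"
    unfolding bdd_above_insert by (rule bdd_aboveI2)
  show "0 \<le> c_pu \<Omega> Vh Vt K Os P"
    unfolding c_pu_def by (rule cSup_upper[OF _ bdd]) simp
  show "?s \<phi> \<le> c_pu \<Omega> Vh Vt K Os P * H1_norm \<Omega> \<phi>" if \<phi>: "\<phi> \<in> Vh"
  proof (cases "\<phi> = 0")
    \<comment> \<open>The supremum omits \<open>\<phi> = 0\<close>; there \<open>bound\<close> makes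
      the left side at most 0.\<close>
    case True
    then show ?thesis using bound[OF \<phi>] H1_norm_zero by simp
  next
    case False
    then have "?s \<phi> / H1_norm \<Omega> \<phi> \<le> c_pu \<Omega> Vh Vt K Os P"
      unfolding c_pu_def using \<phi> by (intro cSup_upper[OF _ bdd] insertI2 imageI) simp
    then show ?thesis using pos[of \<phi>] \<phi> False by (simp add: pos_divide_le_eq)
  qed
qed

text \<open>For near-maximizers \<open>x\<^sub>k\<close> of \<open>g\<close> on the unit balls, test \<open>g\<close> with the
  orthogonal sum of the \<open>g(x\<^sub>k) x\<^sub>k\<close>.\<close>

lemma sum_dual_norm_orthogonal_le:
  assumes S: "subspace S" "S \<subseteq> H1 \<Omega>" and g: "linear_map_on S g"
    and c: "\<And>v. v \<in> S \<Longrightarrow> \<bar>g v\<bar> \<le> c * H1_norm \<Omega> v"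
    and K: "finite K" "\<And>k. k \<in> K \<Longrightarrow> subspace (Os k)" "\<And>k. k \<in> K \<Longrightarrow> Os k \<subseteq> S"
    and orth: "\<And>k l x y. k \<in> K \<Longrightarrow> l \<in> K \<Longrightarrow> k \<noteq> l \<Longrightarrow> x \<in> Os k \<Longrightarrow> y \<in> Os l \<Longrightarrow> H1_inner \<Omega> x y = 0"
  shows "(\<Sum>k\<in>K. (dual_norm \<Omega> (Os k) g)\<^sup>2) \<le> c\<^sup>2"
  unfolding dual_norm_def
proof (rule sum_SUP_squares_le[OF K(1)])
  fix k assume k: "k \<in> K"
  show "{\<phi> \<in> Os k. H1_norm \<Omega> \<phi> \<le> 1} \<noteq> {}" by (rule unit_ball_nonempty[OF K(2)[OF k]])
  have "g \<in> dual_space \<Omega> (Os k)"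
    using linear_map_on_subset[OF g K(3)[OF k]] c K(3)[OF k] unfolding dual_space_def by blast
  then show "bdd_above ((\<lambda>\<phi>. \<bar>g \<phi>\<bar>) ` {\<phi> \<in> Os k. H1_norm \<Omega> \<phi> \<le> 1})"
    by (rule dual_space_bdd_above)
next
  fix x assume x: "\<And>k. k \<in> K \<Longrightarrow> x k \<in> {\<phi> \<in> Os k. H1_norm \<Omega> \<phi> \<le> 1}"
  define T where "T = (\<Sum>k\<in>K. (g (x k))\<^sup>2)"
  let ?f = "\<lambda>k. g (x k) *\<^sub>R x k"
  have xS: "x k \<in> S" and fO: "?f k \<in> Os k" if "k \<in> K" for k
    using x[OF that] K(3)[OF that] subspace_scale[OF K(2)[OF that]] by auto
  have fS: "?f k \<in> S" if "k \<in> K" for k using fO K(3) that by blast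
  have fH: "?f k \<in> H1 \<Omega>" if "k \<in> K" for k using fS[OF that] S(2) by blast
  have sumS: "(\<Sum>k\<in>K. ?f k) \<in> S" by (rule subspace_sum[OF S(1) fS])
  have T: "T = g (\<Sum>k\<in>K. ?f k)"
  proof -
    have "g (\<Sum>k\<in>K. ?f k) = (\<Sum>k\<in>K. g (?f k))"
      using fS by (rule linear_map_on_sum[OF S(1) g K(1)])
    also have "\<dots> = T"
      unfolding T_def
      by (rule sum.cong[OF refl]) (simp add: linear_map_on_scaleR[OF g xS] power2_eq_square)
    finally show ?thesis by (rule sym)
  qed
  \<comment> \<open>Weighting \<open>x k\<close> by its own value \<open>g (x k)\<close> makes
    \<open>g\<close> of the sum equal to \<open>T\<close>, while Pythagoras and the unit balls keep
    the squared norm of the sum below the same \<open>T\<close>.\<close>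
  have "(H1_norm \<Omega> (\<Sum>k\<in>K. ?f k))\<^sup>2 = (\<Sum>k\<in>K. (H1_norm \<Omega> (?f k))\<^sup>2)"
  proof (rule H1_norm_sum_orthogonal[OF K(1) fH])
    show "H1_inner \<Omega> (?f k) (?f l) = 0" if "k \<in> K" "l \<in> K" "k \<noteq> l" for k l
      by (rule orth[OF that fO[OF that(1)] fO[OF that(2)]])
  qed
  also have "\<dots> \<le> T"
    unfolding T_def
  proof (rule sum_mono)
    fix k assume k: "k \<in> K"
    then have "x k \<in> H1 \<Omega>" using xS S(2) by blast
    then have "(H1_norm \<Omega> (?f k))\<^sup>2 = (g (x k))\<^sup>2 * (H1_norm \<Omega> (x k))\<^sup>2"
      by (simp add: H1_norm_scaleR power_mult_distrib)
    also have "\<dots> \<le> (g (x k))\<^sup>2 * 1"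
      using x[OF k] H1_norm_nonneg by (intro mult_left_mono) (auto intro: power_le_one)
    finally show "(H1_norm \<Omega> (?f k))\<^sup>2 \<le> (g (x k))\<^sup>2" by simp
  qed
  finally have norm: "(H1_norm \<Omega> (\<Sum>k\<in>K. ?f k))\<^sup>2 \<le> T" .
  have T0: "0 \<le> T" by (simp add: T_def sum_nonneg)
  have "T \<le> c * H1_norm \<Omega> (\<Sum>k\<in>K. ?f k)" using c[OF sumS] T by simp
  \<comment> \<open>Squaring gives \<open>T^2 \<le> c^2 * T\<close>, and one factor \<open>T\<close>
    cancels unless it is 0. As \<open>T\<close> is nonnegative, no sign condition on
    \<open>c\<close> arises.\<close>
  then have "T\<^sup>2 \<le> (c * H1_norm \<Omega> (\<Sum>k\<in>K. ?f k))\<^sup>2" using T0 by (rule power_mono)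
  also have "\<dots> \<le> c\<^sup>2 * T"
    using norm by (simp add: power_mult_distrib mult_left_mono)
  finally have "T * T \<le> c\<^sup>2 * T" by (simp add: power2_eq_square)
  then have "T \<le> c\<^sup>2" using T0 by (cases "T = 0") (auto simp: mult_le_cancel_right)
  then show "(\<Sum>k\<in>K. \<bar>g (x k)\<bar>\<^sup>2) \<le> c\<^sup>2" by (simp add: T_def)
qed

end

theorem corollary5p3:
  fixes \<Omega> :: "plane set"
    and V Vh Vt :: "aefun set"
    and \<P> :: "(real ^ 'p::finite) set"
    and \<mu> :: "real ^ 'p"
    and a :: "real ^ 'p \<Rightarrow> aefun \<Rightarrow> aefun \<Rightarrow> real"
    and f :: "real ^ 'p \<Rightarrow> aefun \<Rightarrow> real"
    and \<alpha> \<gamma> :: "real ^ 'p \<Rightarrow> real"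
    and u ut :: aefun
    and \<Upsilon> :: "'i set"
    and Os :: "'i \<Rightarrow> aefun set"
    and P :: "'i \<Rightarrow> aefun \<Rightarrow> aefun"
    and J :: nat
    and \<Upsilon>' :: "nat \<Rightarrow> 'i set"
  assumes "polygonal_domain \<Omega>"
    and "subspace V" and "H10 \<Omega> \<subseteq> V" and "V \<subseteq> H1 \<Omega>"
    and "subspace Vh" and "Vh \<subseteq> V" and "\<exists>B. finite B \<and> Vh = span B"
    and "\<And>\<nu>. \<nu> \<in> \<P> \<Longrightarrow> bilinear_form_on V (a \<nu>)"
    and "\<And>\<nu>. \<nu> \<in> \<P> \<Longrightarrow> f \<nu> \<in> dual_space \<Omega> V"
    and "\<And>\<nu>. \<nu> \<in> \<P> \<Longrightarrow> \<alpha> \<nu> > 0"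
    and "\<And>\<nu> \<phi>. \<nu> \<in> \<P> \<Longrightarrow> \<phi> \<in> V \<Longrightarrow> \<alpha> \<nu> * (H1_norm \<Omega> \<phi>)\<^sup>2 \<le> a \<nu> \<phi> \<phi>"
    and "\<And>\<nu> \<phi> \<psi>. \<nu> \<in> \<P> \<Longrightarrow> \<phi> \<in> V \<Longrightarrow> \<psi> \<in> V \<Longrightarrow>
           \<bar>a \<nu> \<phi> \<psi>\<bar> \<le> \<gamma> \<nu> * H1_norm \<Omega> \<phi> * H1_norm \<Omega> \<psi>"
    and "\<mu> \<in> \<P>"
    and "subspace Vt" and "Vt \<subseteq> Vh"
    and "u \<in> Vh" and "\<forall>v\<in>Vh. a \<mu> u v = f \<mu> v"
    and "ut \<in> Vt" and "\<forall>v\<in>Vt. a \<mu> ut v = f \<mu> v"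
    and "finite \<Upsilon>"
    and "\<And>\<xi>. \<xi> \<in> \<Upsilon> \<Longrightarrow> subspace (Os \<xi>) \<and> Os \<xi> \<subseteq> Vh"
    and "\<And>\<xi>. \<xi> \<in> \<Upsilon> \<Longrightarrow> continuous_linear_map \<Omega> Vh (Os \<xi>) (P \<xi>)"
    and "\<And>\<phi>. \<phi> \<in> Vh \<Longrightarrow> (\<Sum>\<xi>\<in>\<Upsilon>. P \<xi> \<phi>) = \<phi>"
    and "(\<Union>j\<in>{1..J}. \<Upsilon>' j) = \<Upsilon>" and "disjoint_family_on \<Upsilon>' {1..J}"
    and "\<And>j \<xi>\<^sub>1 \<xi>\<^sub>2 x y. j \<in> {1..J} \<Longrightarrow> \<xi>\<^sub>1 \<in> \<Upsilon>' j \<Longrightarrow> \<xi>\<^sub>2 \<in> \<Upsilon>' j \<Longrightarrow> \<xi>\<^sub>1 \<noteq> \<xi>\<^sub>2 \<Longrightarrow>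
           x \<in> Os \<xi>\<^sub>1 \<Longrightarrow> y \<in> Os \<xi>\<^sub>2 \<Longrightarrow> H1_inner \<Omega> x y = 0"
  shows "H1_norm \<Omega> (u - ut) \<le> Delta_loc \<Omega> Vh Vt \<Upsilon> Os P (a \<mu>) (f \<mu>) (\<alpha> \<mu>) ut
    \<and> Delta_loc \<Omega> Vh Vt \<Upsilon> Os P (a \<mu>) (f \<mu>) (\<alpha> \<mu>) ut
        \<le> \<gamma> \<mu> * sqrt (real J) * c_pu \<Omega> Vh Vt \<Upsilon> Os P / \<alpha> \<mu> * H1_norm \<Omega> (u - ut)"
proof -
  note V = \<open>subspace V\<close> \<open>V \<subseteq> H1 \<Omega>\<close> and Vh = \<open>subspace Vh\<close> \<open>Vh \<subseteq> V\<close>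
    and Vt = \<open>subspace Vt\<close> \<open>Vt \<subseteq> Vh\<close> and Os = assms(21)[THEN conjunct1] assms(21)[THEN conjunct2]
    and orth = assms(26)
  interpret bounded_open_plane_set \<Omega>
    using \<open>polygonal_domain \<Omega>\<close> by unfold_locales (auto simp: polygonal_domain_def)
  define e where "e = u - ut"
  define R where "R = residual (a \<mu>) (f \<mu>) ut"
  define c where "c = c_pu \<Omega> Vh Vt \<Upsilon> Os P"
  define N where "N = (\<lambda>\<xi>. dual_norm \<Omega> (Os \<xi>) R)"
  define E where "E = H1_norm \<Omega> e"
  have VhH: "Vh \<subseteq> H1 \<Omega>" using Vh(2) V(2) by blast
  have utVh: "ut \<in> Vh" using Vt \<open>ut \<in> Vt\<close> by blast
  then have e: "e \<in> Vh" unfolding e_def by (rule subspace_diff[OF Vh(1) \<open>u \<in> Vh\<close>])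
  have eV: "e \<in> V" using e Vh by blast
  have bil: "bilinear_form_on V (a \<mu>)" using assms(8) \<open>\<mu> \<in> \<P>\<close> by blast
  have \<alpha>: "\<alpha> \<mu> > 0" using assms(10) \<open>\<mu> \<in> \<P>\<close> by blast
  \<comment> \<open>The equation for \<open>u\<close> on all of \<open>Vh\<close> replaces
    \<open>f\<close> by \<open>a(u, .)\<close>; linearity and the bound of \<open>R\<close> on
    \<open>Vh\<close> are then read off from \<open>a(e, .)\<close>.\<close>
  have R_eq: "R v = a \<mu> e v" if v: "v \<in> Vh" for v
  proof -
    have "linear_map_on V (\<lambda>x. a \<mu> x v)" using bil v Vh(2) unfolding bilinear_form_on_def by blast
    then have "a \<mu> (u - ut) v = a \<mu> u v - a \<mu> ut v"
      using linear_map_on_diff[OF V(1), of "\<lambda>x. a \<mu> x v" u ut] \<open>u \<in> Vh\<close> utVh Vh(2) by blast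
    then show ?thesis using assms(17) v by (simp add: R_def residual_def e_def)
  qed
  have a_lin: "linear_map_on V (a \<mu> e)" using bil eV unfolding bilinear_form_on_def by blast
  have R_lin: "linear_map_on Vh R"
    unfolding linear_map_on_def
  proof (intro conjI ballI allI)
    fix x y k assume x: "x \<in> Vh" and y: "y \<in> Vh"
    then show "R (x + y) = R x + R y"
      using linear_map_on_add[OF a_lin, of x y] Vh(2) subspace_add[OF Vh(1) x y]
      by (simp add: R_eq subset_iff)
  next
    fix k x assume x: "x \<in> Vh"
    then show "R (k *\<^sub>R x) = k *\<^sub>R R x"
      using linear_map_on_scaleR[OF a_lin, of x k] Vh(2) subspace_scale[OF Vh(1) x]
      by (simp add: R_eq subset_iff)
  qed
  have R_le: "\<bar>R v\<bar> \<le> \<gamma> \<mu> * E * H1_norm \<Omega> v" if v: "v \<in> Vh" for v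
    using assms(12)[OF \<open>\<mu> \<in> \<P>\<close> eV, of v] v Vh(2) R_eq[OF v] unfolding E_def by auto
  have R_dual: "R \<in> dual_space \<Omega> (Os \<xi>)" if "\<xi> \<in> \<Upsilon>" for \<xi>
    using linear_map_on_subset[OF R_lin Os(2)[OF that]] R_le Os(2)[OF that]
    unfolding dual_space_def by blast
  \<comment> \<open>Galerkin orthogonality: the equation for \<open>ut\<close> says that its
    residual annihilates \<open>Vt\<close>.\<close>
  have R_Vt: "R v = 0" if "v \<in> Vt" for v
    using assms(19) that by (simp add: R_def residual_def)
  have OsH: "Os \<xi> \<subseteq> H1 \<Omega>" if "\<xi> \<in> \<Upsilon>" for \<xi> using Os(2)[OF that] VhH by blast
  have P_in: "P \<xi> e \<in> Os \<xi>" if "\<xi> \<in> \<Upsilon>" for \<xi>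
    using assms(22)[OF that] e unfolding continuous_linear_map_def by blast
  have E0: "0 \<le> E" unfolding E_def by (rule H1_norm_nonneg)
  have c0: "0 \<le> c" unfolding c_def
    by (rule c_pu_nonneg[OF Vh(1) VhH Vt(1) \<open>finite \<Upsilon>\<close> Os(1) assms(22)])
  have Delta: "Delta_loc \<Omega> Vh Vt \<Upsilon> Os P (a \<mu>) (f \<mu>) (\<alpha> \<mu>) ut
      = 1 / \<alpha> \<mu> * c * sqrt (\<Sum>\<xi>\<in>\<Upsilon>. (N \<xi>)\<^sup>2)"
    by (simp add: Delta_loc_def c_def N_def R_def)
  let ?D = "sqrt (\<Sum>\<xi>\<in>\<Upsilon>. (N \<xi>)\<^sup>2)"
  have D0: "0 \<le> ?D" by (simp add: sum_nonneg)

  have "E \<le> 1 / \<alpha> \<mu> * c * ?D"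
  \<comment> \<open>Coercivity produces \<open>E\<close> squared on the left and one factor
    \<open>E\<close> on the right, so a factor has to be cancelled at the end.\<close>
  proof (cases "E = 0")
    case True
    then show ?thesis using \<alpha> c0 D0 by simp
  next
    case False
    \<comment> \<open>\<open>I \<xi>\<close> is the squared distance of \<open>P \<xi> e\<close>
      from \<open>Vt \<inter> Os \<xi>\<close>: the summand of the quotient defining
      \<open>c_pu\<close>, taken at \<open>\<phi> = e\<close>.\<close>
    define I where "I = (\<lambda>\<xi>. INF \<psi>\<in>Vt \<inter> Os \<xi>. (H1_norm \<Omega> (P \<xi> e - \<psi>))\<^sup>2)"
    have ne: "Vt \<inter> Os \<xi> \<noteq> {}" if "\<xi> \<in> \<Upsilon>" for \<xi>
      using subspace_0[OF Vt(1)] subspace_0[OF Os(1)[OF that]] by blast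
    have I0: "0 \<le> I \<xi>" if "\<xi> \<in> \<Upsilon>" for \<xi>
      unfolding I_def by (rule cINF_greatest[OF ne[OF that]]) simp
    have "\<alpha> \<mu> * E\<^sup>2 \<le> a \<mu> e e" unfolding E_def by (rule assms(11)[OF \<open>\<mu> \<in> \<P>\<close> eV])
    also have "\<dots> = R e" using R_eq[OF e] by simp
    also have "\<dots> = R (\<Sum>\<xi>\<in>\<Upsilon>. P \<xi> e)" using assms(23)[OF e] by simp
    also have "\<dots> = (\<Sum>\<xi>\<in>\<Upsilon>. R (P \<xi> e))"
      using P_in Os(2) by (intro linear_map_on_sum[OF Vh(1) R_lin \<open>finite \<Upsilon>\<close>]) blast
    also have "\<dots> \<le> (\<Sum>\<xi>\<in>\<Upsilon>. N \<xi> * sqrt (I \<xi>))"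
    proof (rule sum_mono)
      fix \<xi> assume \<xi>: "\<xi> \<in> \<Upsilon>"
      have "\<bar>R (P \<xi> e)\<bar> \<le> N \<xi> * sqrt (I \<xi>)"
        unfolding N_def I_def
        by (rule dual_norm_annihilator_bound[OF Os(1)[OF \<xi>] OsH[OF \<xi>] R_dual[OF \<xi>] P_in[OF \<xi>] _ ne[OF \<xi>]])
           (use R_Vt in auto)
      then show "R (P \<xi> e) \<le> N \<xi> * sqrt (I \<xi>)" by simp
    qed
    also have "\<dots> \<le> L2_set N \<Upsilon> * L2_set (\<lambda>\<xi>. sqrt (I \<xi>)) \<Upsilon>"
    proof (rule order_trans[OF sum_mono L2_set_mult_ineq])
      show "N \<xi> * sqrt (I \<xi>) \<le> \<bar>N \<xi>\<bar> * \<bar>sqrt (I \<xi>)\<bar>" for \<xi>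
        using abs_ge_self[of "N \<xi> * sqrt (I \<xi>)"] by (simp only: abs_mult)
    qed
    also have "L2_set (\<lambda>\<xi>. sqrt (I \<xi>)) \<Upsilon> = sqrt (\<Sum>\<xi>\<in>\<Upsilon>. I \<xi>)"
      unfolding L2_set_def using I0 by (intro arg_cong[where f = sqrt] sum.cong) auto
    also have "L2_set N \<Upsilon> * sqrt (\<Sum>\<xi>\<in>\<Upsilon>. I \<xi>) \<le> ?D * (c * E)"
      unfolding L2_set_def
    proof (rule mult_left_mono[OF _ D0])
      show "sqrt (\<Sum>\<xi>\<in>\<Upsilon>. I \<xi>) \<le> c * E"
        unfolding I_def c_def E_def
        by (rule le_c_pu[OF Vh(1) VhH Vt(1) \<open>finite \<Upsilon>\<close> Os(1) assms(22) e])
    qed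
    finally have "(\<alpha> \<mu> * E) * E \<le> (c * ?D) * E" by (simp add: power2_eq_square mult_ac)
    then have "\<alpha> \<mu> * E \<le> c * ?D" using False E0 by (simp add: mult_le_cancel_right)
    then show ?thesis using \<alpha> by (simp add: pos_le_divide_eq mult.commute)
  qed
  moreover have "1 / \<alpha> \<mu> * c * ?D \<le> \<gamma> \<mu> * sqrt (real J) * c / \<alpha> \<mu> * E"
  proof -
    \<comment> \<open>The sign of \<open>\<gamma> \<mu>\<close> is not among the assumptions. For
      nonzero \<open>E\<close>, the continuity bound tested at \<open>e\<close> forces nonnegativity
      of the product, which is what lets the root undo its square below.\<close>
    have \<gamma>E: "0 \<le> \<gamma> \<mu> * E"
    proof (cases "E = 0")
      case False
      have "0 \<le> \<gamma> \<mu> * E * E" using R_le[OF e] by (simp add: E_def)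
      then show ?thesis using False E0 by (simp add: zero_le_mult_iff)
    qed simp
    have fin: "finite (\<Upsilon>' j)" if "j \<in> {1..J}" for j
      using \<open>finite \<Upsilon>\<close> assms(24) that by (metis UN_upper finite_subset)
    have "(\<Sum>\<xi>\<in>\<Upsilon>. (N \<xi>)\<^sup>2) = (\<Sum>j\<in>{1..J}. \<Sum>\<xi>\<in>\<Upsilon>' j. (N \<xi>)\<^sup>2)"
      unfolding assms(24)[symmetric]
      using fin assms(25) by (intro sum.UNION_disjoint) (auto simp: disjoint_family_on_def)
    \<comment> \<open>Within one class the spaces are mutually orthogonal, so the whole class costs
      no more than a single global dual norm squared; the \<open>J\<close> equal bounds produce the
      factor \<open>sqrt (real J)\<close>.\<close>
    also have "\<dots> \<le> (\<Sum>j\<in>{1..J}. (\<gamma> \<mu> * E)\<^sup>2)"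
    proof (rule sum_mono)
      fix j assume j: "j \<in> {1..J}"
      have sub: "\<xi> \<in> \<Upsilon>" if "\<xi> \<in> \<Upsilon>' j" for \<xi> using assms(24) j that by blast
      show "(\<Sum>\<xi>\<in>\<Upsilon>' j. (N \<xi>)\<^sup>2) \<le> (\<gamma> \<mu> * E)\<^sup>2"
        unfolding N_def
        by (rule sum_dual_norm_orthogonal_le[OF Vh(1) VhH R_lin R_le fin[OF j]])
           (use sub Os orth[OF j] in blast)+
    qed
    also have "\<dots> = real J * (\<gamma> \<mu> * E)\<^sup>2" by simp
    finally have "?D \<le> sqrt (real J * (\<gamma> \<mu> * E)\<^sup>2)" by (rule real_sqrt_le_mono)
    also have "\<dots> = sqrt (real J) * (\<gamma> \<mu> * E)" using \<gamma>E by (simp add: real_sqrt_mult)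
    finally have "(1 / \<alpha> \<mu> * c) * ?D \<le> (1 / \<alpha> \<mu> * c) * (sqrt (real J) * (\<gamma> \<mu> * E))"
      using \<alpha> c0 by (intro mult_left_mono) auto
    then show ?thesis by (simp add: mult_ac)
  qed
  ultimately show ?thesis
    unfolding Delta c_def[symmetric] E_def[symmetric] e_def[symmetric] by blast
qed

end
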